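(* The coefficients $a_n$ of the recurrence relation $zQ_n(z)=Q_{n+1}(z)+a_nQ_{n-p}(z)$, $n\ge p$, satisfied by the polynomials $Q_n$, are all positive, i.e., $a_n>0$ for every $n\ge p$.
   Context: Fix an integer $p\ge 1$. For $0\le j\le p-1$ let $a_j<b_j$ be real numbers (interval endpoints, not to be confused with the recurrence coefficients $a_n$, $n\ge p$) with $0\le a_j<b_j$ if $j$ is even and $a_j<b_j\le 0$ if $j$ is odd, and let $\Gamma_j=\{z\in\mathbb{C}: z^{p+1}\in[a_j,b_j]\}$. Assume $\Gamma_j\cap\Gamma_{j+1}=\emptyset$ for $0\le j\le p-2$. For each $j$ let $\sigma_j$ be a positive finite Borel measure on $\Gamma_j$, invariant under rotation by the angle $2\pi/(p+1)$, with infinitely many points in its support. Set $s_{k,k}=\sigma_k$ and, for $0\le k<j\le p-1$, $ds_{k,j}(z)=\Big(\int_{\Gamma_{k+1}}\frac{ds_{k+1,j}(t)}{z-t}\Big)d\sigma_k(z)$ on $\Gamma_k$; put $s_j=s_{0,j}$ (the Nikishin system generated by $\sigma_0,\ldots,\sigma_{p-1}$). $Q_n$ ($n\ge0$) is the monic polynomial of lowest degree satisfying $\int_{\Gamma_0}Q_n(z)z^l\,ds_j(z)=0$ for $l=0,\ldots,\lfloor\frac{n-j-1}{p}\rfloor$, $0\le j\le p-1$. These polynomials satisfy a recurrence $zQ_n(z)=Q_{n+1}(z)+a_nQ_{n-p}(z)$, $n\ge p$, with real coefficients $a_n$, which defines the $a_n$. *)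

theory Defs
  imports "HOL-Analysis.Analysis" "HOL-Computational_Algebra.Polynomial"
begin

definition star_set :: "nat \<Rightarrow> real \<Rightarrow> real \<Rightarrow> complex set" where
  "star_set p a b = {z. z ^ (p + 1) \<in> complex_of_real ` {a..b}}"

definition measure_support :: "'a::topological_space measure \<Rightarrow> 'a set" where
  "measure_support M = {x. \<forall>U. open U \<longrightarrow> x \<in> U \<longrightarrow> emeasure M U > 0}"

(* A measure on the set S is represented by a Borel measure on the whole plane that gives
   the complement of S mass zero. *)
definition star_measure :: "nat \<Rightarrow> complex set \<Rightarrow> complex measure \<Rightarrow> bool" where
  "star_measure p S \<mu> \<longleftrightarrow>
     sets \<mu> = sets borel \<and> finite_measure \<mu> \<and> emeasure \<mu> (- S) = 0 \<and>
     distr \<mu> borel (\<lambda>z. cis (2 * pi / real (p + 1)) * z) = \<mu> \<and>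
     infinite (measure_support \<mu>)"

(* The measures s_{k,j} are complex, so each one is given by its density with respect to the
   positive measure sigma_k: d s_{k,j} = nikishin_density sigma k j d sigma_k. The density of
   s_{k,k} is 1, and that of s_{k,j} for k < j is the Cauchy transform of s_{k+1,j}, in which
   d s_{k+1,j} is again written as density times d sigma_{k+1}. Only its values on the star
   supporting sigma_k matter. *)
function nikishin_density :: "(nat \<Rightarrow> complex measure) \<Rightarrow> nat \<Rightarrow> nat \<Rightarrow> complex \<Rightarrow> complex" where
  "nikishin_density \<sigma> k j z =
     (if k < j then (\<integral>t. 1 / (z - t) * nikishin_density \<sigma> (Suc k) j t \<partial>\<sigma> (Suc k)) else 1)"
  by pat_completeness auto
termination by (relation "Wellfounded.measure (\<lambda>(\<sigma>, k, j, z). j - k)") auto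

declare nikishin_density.simps [simp del]

(* The integral of f with respect to s_{k,j}. *)
definition nikishin_integral ::
    "(nat \<Rightarrow> complex measure) \<Rightarrow> nat \<Rightarrow> nat \<Rightarrow> (complex \<Rightarrow> complex) \<Rightarrow> complex" where
  "nikishin_integral \<sigma> k j f = (\<integral>z. f z * nikishin_density \<sigma> k j z \<partial>\<sigma> k)"

(* The bound on l is computed in int because n - j - 1 may be negative; div on int rounds
   downwards, so a negative numerator imposes no condition. *)
definition multi_orthogonal :: "nat \<Rightarrow> (nat \<Rightarrow> complex measure) \<Rightarrow> nat \<Rightarrow> complex poly \<Rightarrow> bool" where
  "multi_orthogonal p \<sigma> n P \<longleftrightarrow>
     (\<forall>j<p. \<forall>l::nat. int l \<le> (int n - int j - 1) div int p \<longrightarrow>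
        nikishin_integral \<sigma> 0 j (\<lambda>z. poly P z * z ^ l) = 0)"

definition multi_orthogonal_poly ::
    "nat \<Rightarrow> (nat \<Rightarrow> complex measure) \<Rightarrow> nat \<Rightarrow> complex poly \<Rightarrow> bool" where
  "multi_orthogonal_poly p \<sigma> n P \<longleftrightarrow>
     is_arg_min degree (\<lambda>R. lead_coeff R = 1 \<and> multi_orthogonal p \<sigma> n R) P"

end

theory Submission
  imports Defs
begin

text \<open>Push every \<open>\<sigma>\<^sub>j\<close> forward under \<open>z \<mapsto> z ^ (p + 1)\<close>: rotation invariance annihilates all moments of
  \<open>s\<^sub>j\<close> except those whose order is \<open>j\<close> modulo \<open>p + 1\<close>, and the remaining ones are moments of a Nikishin
  type system on the real line. Write \<open>n = (p + 1) D + c\<close> with \<open>c \<le> p\<close>. The part of \<open>Q\<^sub>n\<close> of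
  residue \<open>c\<close> becomes a monic real polynomial of degree \<open>D\<close> orthogonal to \<open>D\<close> consecutive
  functions \<open>u\<^sub>c, \<dots>, u\<^bsub>c+D-1\<^esub>\<close>, where \<open>u\<^bsub>ip+j\<^esub>\<close> is \<open>x ^ i\<close> times the \<open>j\<close>-th density. Integrating
  the recurrence gives \<open>a\<^sub>n = h\<^sub>n / h\<^bsub>n-p\<^esub>\<close>, where \<open>h\<^sub>n\<close> is the pairing of \<open>Q\<^sub>n\<close> with the first
  function that it is not orthogonal to.

  The signs of the \<open>h\<^sub>n\<close> follow from a Chebyshev property with explicit orientation: a
  combination of \<open>u\<^sub>c, \<dots>, u\<^bsub>c+d\<^esub>\<close> with \<open>d\<close> prescribed zeros has no other zero, and its sign
  is known. Such a combination is a polynomial plus the Cauchy transform of a combination at the next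
  level, so Lagrange interpolation at its zeros turns the vanishing into orthogonality relations for
  the latter, which therefore changes sign sufficiently often, and one descends through the levels.\<close>

subsection \<open>Interpolation and sign changes\<close>

text \<open>Only the quotient \<open>h_n / h_(n-p)\<close> is wanted, but the pairings have no
  constant sign: it depends on \<open>c\<close>, on \<open>D\<close> and on the sides of 0 on which
  the intervals lie. Counting zeros is therefore not enough, and the induction over the levels
  carries the sign \<open>sign_pattern\<close>. It is never put in closed form; two identities
  suffice. Replacing \<open>n\<close> by \<open>n - p\<close> turns \<open>(c, D)\<close> into
  \<open>(c + 1, D - 1)\<close>, which keeps the last index \<open>c + D\<close>
  (\<open>sign_pattern_step\<close>), or, if \<open>c = p\<close>, into \<open>(0, D)\<close>, which
  divides all functions by \<open>x\<close> (\<open>sign_pattern_wrap\<close>). The zero count rests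
  on one balance: \<open>d + 1\<close> consecutive functions consist of \<open>A\<close> pure powers
  and \<open>B\<close> Cauchy transforms, \<open>A + B = d + 1\<close>. Multipliers of degree below
  \<open>B\<close> yield orthogonality relations at the next level; degree \<open>B\<close> is the
  first that can see the top coefficient. Zero may be an endpoint of an interval, and factors
  \<open>x\<close> vanish there, so strict signs are claimed on punctured intervals only.
  \<open>Q n\<close> is merely assumed to have least degree; that this degree is \<open>n\<close>
  follows from the same Chebyshev property.\<close>

lemma underdetermined_system:
  fixes a :: "nat \<Rightarrow> nat \<Rightarrow> 'a::field"
  shows "\<exists>x. (\<exists>k\<le>m. x k \<noteq> 0) \<and> (\<forall>i<m. (\<Sum>k\<le>m. a i k * x k) = 0)"
proof (induction m arbitrary: a)
  case 0
  show ?case by (rule exI[of _ "\<lambda>_. 1"]) auto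
next
  case (Suc m)
  show ?case
  proof (cases "\<forall>i<Suc m. a i (Suc m) = 0")
    case True
    then show ?thesis
      by (intro exI[of _ "\<lambda>k. if k = Suc m then 1 else 0"]) (auto intro!: sum.neutral)
  next
    case False
    then obtain r where r: "r < Suc m" "a r (Suc m) \<noteq> 0" by auto
    \<comment> \<open>Row \<open>r\<close> is the pivot for the last unknown; \<open>row\<close>
      enumerates the other rows, skipping \<open>r\<close>.\<close>
    define row where "row i = (if i < r then i else Suc i)" for i
    obtain y where y: "\<exists>k\<le>m. y k \<noteq> 0"
      "\<And>i. i < m \<Longrightarrow> (\<Sum>k\<le>m. (a (row i) k - a (row i) (Suc m) / a r (Suc m) * a r k) * y k) = 0"
      using Suc[of "\<lambda>i k. a (row i) k - a (row i) (Suc m) / a r (Suc m) * a r k"] by auto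
    define w where "w = - (\<Sum>k\<le>m. a r k * y k) / a r (Suc m)"
    define x where "x = y(Suc m := w)"
    have sum: "(\<Sum>k\<le>Suc m. a i k * x k) = (\<Sum>k\<le>m. a i k * y k) + a i (Suc m) * w" for i
      by (auto simp: x_def intro!: sum.cong)
    have "(\<Sum>k\<le>Suc m. a i k * x k) = 0" if "i < Suc m" for i
    proof (cases "i = r")
      case True
      then show ?thesis using r unfolding sum by (simp add: w_def)
    next
      case False
      define i' where "i' = (if i < r then i else i - 1)"
      have "i' < m" "row i' = i" using False that r by (auto simp: i'_def row_def)
      then have "(\<Sum>k\<le>m. (a i k - a i (Suc m) / a r (Suc m) * a r k) * y k) = 0" using y(2) by metis
      then have "(\<Sum>k\<le>m. a i k * y k) = a i (Suc m) / a r (Suc m) * (\<Sum>k\<le>m. a r k * y k)"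
        by (simp add: algebra_simps sum_subtractf sum_distrib_left)
      then show ?thesis unfolding sum by (simp add: w_def)
    qed
    moreover have "\<exists>k\<le>Suc m. x k \<noteq> 0" using y(1) unfolding x_def by (metis fun_upd_other le_SucI not_less_eq_eq order_refl)
    ultimately show ?thesis by blast
  qed
qed

text \<open>The left side is the divided difference of \<open>f\<close> at the nodes
  \<open>X\<close>. It is the top coefficient of the Lagrange interpolant, and the interpolant is
  \<open>f\<close> itself.\<close>

lemma coeff_eq_sum_divided:
  fixes f :: "'a::field poly"
  assumes "finite X" "card X = Suc d" "degree f \<le> d"
  shows "(\<Sum>y\<in>X. poly f y / (\<Prod>z\<in>X - {y}. y - z)) = coeff f d"
proof -
  define L where "L = (\<Sum>y\<in>X. smult (poly f y / (\<Prod>z\<in>X - {y}. y - z)) (\<Prod>z\<in>X - {y}. [:-z, 1:]))"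
  have deg: "degree (\<Prod>z\<in>X - {y}. [:-z, 1:]) = d" if "y \<in> X" for y
    using that assms by (subst degree_prod_eq_sum_degree) auto
  have lead: "coeff (\<Prod>z\<in>X - {y}. [:-z, 1:]) d = 1" if "y \<in> X" for y
    using deg[OF that] lead_coeff_prod[of "\<lambda>z. [:-z, 1:]" "X - {y}"] by simp
  have "f = L"
  proof (rule poly_eqI_degree)
    fix x assume x: "x \<in> X"
    have "poly L x = (\<Sum>y\<in>X. if y = x then poly f x else 0)"
      unfolding L_def poly_sum
    proof (rule sum.cong)
      fix y assume "y \<in> X"
      show "poly (smult (poly f y / (\<Prod>z\<in>X - {y}. y - z)) (\<Prod>z\<in>X - {y}. [:-z, 1:])) x =
        (if y = x then poly f x else 0)"
      proof (cases "y = x")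
        case True
        have "(\<Prod>z\<in>X - {x}. x - z) \<noteq> 0" using assms by auto
        then show ?thesis using True by (simp add: poly_prod)
      next
        case False
        then have "(\<Prod>z\<in>X - {y}. x - z) = 0" using x assms by (intro prod_zero) auto
        then show ?thesis using False by (simp add: poly_prod)
      qed
    qed simp
    then show "poly f x = poly L x" using x assms by simp
  next
    show "degree f < card X" using assms by simp
    have "degree L \<le> d" unfolding L_def
      by (rule degree_sum_le) (auto simp: assms deg intro: order.trans[OF degree_smult_le])
    then show "degree L < card X" using assms by simp
  qed
  then have "coeff f d = coeff L d" by simp
  also have "\<dots> = (\<Sum>y\<in>X. poly f y / (\<Prod>z\<in>X - {y}. y - z))"
    by (simp add: L_def coeff_sum lead)
  finally show ?thesis by simp
qed

text \<open>Take \<open>t\<close> as an additional node: the divided difference of \<open>g\<close>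
  then has order \<open>d + 1\<close> and vanishes, and the term of the node \<open>t\<close> is
  moved to the other side.\<close>

lemma sum_divided_cauchy:
  fixes g :: "'a::field poly"
  assumes "finite X" "card X = Suc d" "degree g \<le> d" "t \<notin> X"
  shows "(\<Sum>y\<in>X. poly g y / (y - t) / (\<Prod>z\<in>X - {y}. y - z)) = - poly g t / (\<Prod>y\<in>X. t - y)"
proof -
  have "0 = coeff g (Suc d)" using assms by (simp add: coeff_eq_0)
  also have "\<dots> = (\<Sum>y\<in>insert t X. poly g y / (\<Prod>z\<in>insert t X - {y}. y - z))"
    by (rule coeff_eq_sum_divided[symmetric]) (use assms in auto)
  also have "\<dots> = poly g t / (\<Prod>y\<in>X. t - y) + (\<Sum>y\<in>X. poly g y / (\<Prod>z\<in>insert t X - {y}. y - z))"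
    using assms by (simp add: insert_Diff_if)
  also have "(\<Sum>y\<in>X. poly g y / (\<Prod>z\<in>insert t X - {y}. y - z)) =
      (\<Sum>y\<in>X. poly g y / (y - t) / (\<Prod>z\<in>X - {y}. y - z))"
    by (rule sum.cong) (use assms in \<open>auto simp: insert_Diff_if\<close>)
  finally show ?thesis by (simp add: algebra_simps eq_neg_iff_add_eq_0)
qed

lemma constant_sign:
  fixes f :: "real \<Rightarrow> real"
  assumes "is_interval J" "continuous_on J f" "\<And>x. x \<in> J \<Longrightarrow> f x \<noteq> 0"
  shows "\<exists>\<epsilon>\<in>{1,-1}. \<forall>x\<in>J. \<epsilon> * f x > 0"
proof (rule ccontr)
  assume "\<not> ?thesis"
  then have "\<exists>x\<in>J. 1 * f x \<le> 0" "\<exists>y\<in>J. -1 * f y \<le> 0" by (meson insertCI not_le)+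
  then obtain x y where "x \<in> J" "y \<in> J" "f x \<le> 0" "f y \<ge> 0" by auto
  moreover have "is_interval (f ` J)"
    using assms by (simp add: connected_continuous_image is_interval_connected_1)
  ultimately have "0 \<in> f ` J" unfolding is_interval_1 by blast
  with assms(3) show False by auto
qed

text \<open>Induction on the number of zeros, removing the largest. The set \<open>S\<close> selects
  the zeros at which the sign flips, and \<open>\<epsilon>\<close> is the sign to the right of all
  zeros.\<close>

lemma sign_changes:
  fixes f :: "real \<Rightarrow> real"
  assumes "is_interval J" "continuous_on J f" "finite {x\<in>J. f x = 0}"
  shows "\<exists>S \<epsilon>. S \<subseteq> {x\<in>J. f x = 0} \<and> \<epsilon> \<in> {1,-1} \<and>
           (\<forall>x\<in>J. f x \<noteq> 0 \<longrightarrow> \<epsilon> * (\<Prod>s\<in>S. x - s) * f x > 0)"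
  using assms
proof (induction "card {x\<in>J. f x = 0}" arbitrary: J)
  case 0
  then have "\<And>x. x \<in> J \<Longrightarrow> f x \<noteq> 0" by auto
  from constant_sign[OF 0(2,3) this] show ?case by (intro exI[of _ "{}"]) auto
next
  case (Suc n)
  define Z where "Z = {x\<in>J. f x = 0}"
  have "finite Z" using Suc by (auto simp: Z_def)
  have "Z \<noteq> {}" using Suc(2) unfolding Z_def by (metis card.empty nat.distinct(1))
  define m where "m = Max Z"
  have m: "m \<in> Z" "\<And>z. z \<in> Z \<Longrightarrow> z \<le> m" using \<open>finite Z\<close> \<open>Z \<noteq> {}\<close> by (auto simp: m_def)
  define J1 where "J1 = J \<inter> {..<m}"
  define J2 where "J2 = J \<inter> {m<..}"
  have int: "is_interval J1" "is_interval J2"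
    using Suc.prems(1) by (auto simp: J1_def J2_def intro!: is_interval_Int)
  have cont: "continuous_on J1 f" "continuous_on J2 f"
    using Suc.prems(2) by (auto simp: J1_def J2_def intro: continuous_on_subset)
  have z1: "{x\<in>J1. f x = 0} = Z - {m}" using m by (force simp: J1_def Z_def)
  have "n = card {x\<in>J1. f x = 0}" using Suc(2) m(1) \<open>finite Z\<close> unfolding z1 by (simp add: Z_def)
  from Suc(1)[OF this int(1) cont(1)] obtain S \<epsilon> where S: "S \<subseteq> Z - {m}" "\<epsilon> \<in> {1,-1}"
    "\<And>x. x \<in> J1 \<Longrightarrow> f x \<noteq> 0 \<Longrightarrow> \<epsilon> * (\<Prod>s\<in>S. x - s) * f x > 0"
    unfolding z1 using \<open>finite Z\<close> by auto
  have "f x \<noteq> 0" if "x \<in> J2" for x using m(2)[of x] that by (auto simp: J2_def Z_def)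
  from constant_sign[OF int(2) cont(2) this] obtain \<delta> where \<delta>: "\<delta> \<in> {1,-1}" "\<And>x. x \<in> J2 \<Longrightarrow> \<delta> * f x > 0"
    by blast
  have "finite S" using S \<open>finite Z\<close> by (meson finite_Diff finite_subset)
  have pos: "(\<Prod>s\<in>S. x - s) > 0" if "x \<in> J2" for x
    using S(1) m(2) that by (intro prod_pos) (force simp: J2_def)
  \<comment> \<open>The zero \<open>m\<close> is recorded exactly when the sign
    \<open>\<delta>\<close> on its right differs from the sign \<open>\<epsilon>\<close> inherited
    from its left.\<close>
  define S' where "S' = (if \<delta> = \<epsilon> then S else insert m S)"
  have "\<delta> * (\<Prod>s\<in>S'. x - s) * f x > 0" if "x \<in> J" "f x \<noteq> 0" for x
  proof -
    have "x \<noteq> m" using that m(1) by (auto simp: Z_def)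
    then consider "x \<in> J1" | "x \<in> J2" using \<open>x \<in> J\<close> by (fastforce simp: J1_def J2_def)
    then show ?thesis
    proof cases
      case 1
      have "m - x > 0" using 1 by (simp add: J1_def)
      show ?thesis
      proof (cases "\<delta> = \<epsilon>")
        case True then show ?thesis using S(3)[OF 1 that(2)] by (simp add: S'_def)
      next
        case False
        then have "\<delta> = - \<epsilon>" using S \<delta> by auto
        moreover have "(\<Prod>s\<in>S'. x - s) = (x - m) * (\<Prod>s\<in>S. x - s)"
          using False S(1) \<open>finite S\<close> by (subst prod.insert[symmetric]) (auto simp: S'_def)
        ultimately have "\<delta> * (\<Prod>s\<in>S'. x - s) * f x = (m - x) * (\<epsilon> * (\<Prod>s\<in>S. x - s) * f x)"
          by (simp only:) (simp add: algebra_simps)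
        then show ?thesis using mult_pos_pos[OF \<open>m - x > 0\<close> S(3)[OF 1 that(2)]] by (simp only:)
      qed
    next
      case 2
      then have "x - m > 0" by (simp add: J2_def)
      then have "(\<Prod>s\<in>S'. x - s) > 0" using pos[OF 2] S(1) \<open>finite S\<close>
        by (auto simp: S'_def prod.insert_if)
      then have "(\<Prod>s\<in>S'. x - s) * (\<delta> * f x) > 0" using \<delta>(2)[OF 2] by simp
      then show ?thesis by (simp add: algebra_simps)
    qed
  qed
  moreover have "S' \<subseteq> Z" using S m(1) by (auto simp: S'_def)
  ultimately show ?case using \<delta>(1) unfolding Z_def by blast
qed

subsection \<open>Nikishin systems on the real line\<close>

text \<open>With \<open>\<zeta> = z ^ (p + 1)\<close> this is \<open>z ^ (j - s)\<close> times the density of \<open>s\<^bsub>s,j\<^esub>\<close>; the leading factor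
  \<open>x\<close> stems from this normalisation.\<close>

function line_density :: "(nat \<Rightarrow> real measure) \<Rightarrow> nat \<Rightarrow> nat \<Rightarrow> real \<Rightarrow> real" where
  "line_density M s j x =
     (if s < j then x * (\<integral>t. line_density M (Suc s) j t / (x - t) \<partial>M (Suc s)) else 1)"
  by pat_completeness auto
termination by (relation "Wellfounded.measure (\<lambda>(M, s, j, x). j - s)") auto

declare line_density.simps [simp del]

text \<open>Every point of a nondegenerate interval is a limit of points outside a finite set, so
  continuity extends the inequality to the exceptional points.\<close>

lemma nonneg_on_Icc_if_cofinite:
  fixes f :: "real \<Rightarrow> real"
  assumes "continuous_on {a..b} f" "a < b" "finite Z" "\<And>x. x \<in> {a..b} - Z \<Longrightarrow> f x \<ge> 0" "x \<in> {a..b}"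
  shows "f x \<ge> 0"
proof -
  have "x islimpt {a..b}" using assms(2,5) by (simp add: islimpt_Icc)
  moreover have "{a..b} \<subseteq> Z \<union> ({a..b} - Z)" by auto
  ultimately have "x islimpt (Z \<union> ({a..b} - Z))" using islimpt_subset by blast
  then have lim: "x islimpt ({a..b} - Z)" using assms(3) islimpt_Un_finite by blast
  have "(f \<longlongrightarrow> f x) (at x within ({a..b} - Z))"
    using assms(1,5) by (meson Diff_subset continuous_on tendsto_within_subset)
  moreover have "\<forall>\<^sub>F y in at x within ({a..b} - Z). f y \<ge> 0"
    using assms(4) by (auto simp: eventually_at_topological)
  ultimately show ?thesis using lim by (intro tendsto_lowerbound) (auto simp: trivial_limit_within)
qed

text \<open>\<open>M_cofinite\<close> is what the infinite support becomes on the line: no finite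
  set carries \<open>M j\<close>, hence an integrand that is positive off finitely many points has a
  positive integral.\<close>

locale line_nikishin =
  fixes p :: nat and \<alpha> \<beta> :: "nat \<Rightarrow> real" and M :: "nat \<Rightarrow> real measure"
  assumes even_interval: "j < p \<Longrightarrow> even j \<Longrightarrow> 0 \<le> \<alpha> j \<and> \<alpha> j < \<beta> j"
    and odd_interval: "j < p \<Longrightarrow> odd j \<Longrightarrow> \<alpha> j < \<beta> j \<and> \<beta> j \<le> 0"
    and disjoint: "Suc j < p \<Longrightarrow> {\<alpha> j..\<beta> j} \<inter> {\<alpha> (Suc j)..\<beta> (Suc j)} = {}"
    and sets_M: "j < p \<Longrightarrow> sets (M j) = sets borel"
    and finite_M: "j < p \<Longrightarrow> finite_measure (M j)"
    and AE_M: "j < p \<Longrightarrow> AE x in M j. x \<in> {\<alpha> j..\<beta> j}"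
    and M_cofinite: "j < p \<Longrightarrow> finite Z \<Longrightarrow> emeasure (M j) (- Z) \<noteq> 0"
begin

abbreviation I :: "nat \<Rightarrow> real set" where "I j \<equiv> {\<alpha> j..\<beta> j}"
text \<open>Zero can only be an endpoint of \<open>I j\<close>; removing it leaves an interval on
  which \<open>x\<close> has the strict sign \<open>\<eta> j\<close>.\<close>

abbreviation J :: "nat \<Rightarrow> real set" where "J j \<equiv> I j - {0}"
definition \<eta> :: "nat \<Rightarrow> real" where "\<eta> s = (-1) ^ s"

lemma eta_simps [simp]: "\<eta> (Suc s) = - \<eta> s" "\<eta> s * \<eta> s = 1" "\<eta> s * (\<eta> s * y) = y" "\<eta> s \<noteq> 0" "\<eta> 0 = 1"
  by (auto simp: \<eta>_def simp flip: power_add mult.assoc)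

lemma eta_cases: "\<eta> s = 1 \<or> \<eta> s = -1"
  by (cases "even s") (simp_all add: \<eta>_def)

lemma endpoints: "j < p \<Longrightarrow> \<alpha> j < \<beta> j"
  using even_interval odd_interval by blast

lemma eta_pos: assumes "s < p" "x \<in> J s" shows "\<eta> s * x > 0"
  using even_interval[of s] odd_interval[of s] assms by (cases "even s") (auto simp: \<eta>_def)

lemma eta_sep: assumes "Suc s < p" "x \<in> I s" "t \<in> I (Suc s)" shows "\<eta> s * (x - t) > 0"
proof -
  have "x \<noteq> t" using disjoint[of s] assms by auto
  then show ?thesis
    using even_interval[of s] odd_interval[of s] even_interval[of "Suc s"] odd_interval[of "Suc s"] assms
    by (cases "even s") (auto simp: \<eta>_def)
qed

lemma sep: assumes "Suc s < p" "x \<in> I s" "t \<in> I (Suc s)" shows "x \<noteq> t"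
  using eta_sep[OF assms] by auto

lemma interval_J: assumes "s < p" shows "is_interval (J s)"
  using even_interval[of s] odd_interval[of s] assms
  by (cases "even s") (force simp: is_interval_1)+

lemma integrable_M:
  fixes f :: "real \<Rightarrow> 'b::{banach, second_countable_topology}"
  assumes "s < p" "f \<in> borel_measurable borel" "continuous_on (I s) f"
  shows "integrable (M s) f"
proof -
  interpret finite_measure "M s" using finite_M assms(1) .
  have "compact (f ` I s)" using assms(3) by (intro compact_continuous_image) auto
  then obtain B where "\<And>x. x \<in> I s \<Longrightarrow> norm (f x) \<le> B"
    by (meson bounded_iff compact_imp_bounded imageI)
  then have "AE x in M s. norm (f x) \<le> B" using AE_M[OF assms(1)] by auto
  moreover have "f \<in> borel_measurable (M s)"
    using assms(2) sets_M[OF assms(1)] by (simp cong: measurable_cong_sets)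
  ultimately show ?thesis by (rule integrable_const_bound)
qed

text \<open>Positivity may fail at 0 and on \<open>Z\<close>. Continuity still gives a nonnegative
  integrand, and a vanishing integral would concentrate the measure on a finite set.\<close>

lemma integral_M_pos:
  fixes f :: "real \<Rightarrow> real"
  assumes "s < p" "f \<in> borel_measurable borel" "continuous_on (I s) f" "finite Z"
    "\<And>x. x \<in> J s - Z \<Longrightarrow> f x > 0"
  shows "(\<integral>x. f x \<partial>M s) > 0"
proof -
  have "f x \<ge> 0" if "x \<in> I s" for x
  proof (rule nonneg_on_Icc_if_cofinite[OF assms(3) endpoints[OF assms(1)], of "insert 0 Z"])
    show "f y \<ge> 0" if "y \<in> I s - insert 0 Z" for y
      using assms(5)[of y] that by force
  qed (use assms that in auto)
  then have nonneg: "AE x in M s. f x \<ge> 0" using AE_M[OF assms(1)] by auto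
  have int: "integrable (M s) f" by (rule integrable_M) fact+
  have "(\<integral>x. f x \<partial>M s) \<noteq> 0"
  proof
    assume "(\<integral>x. f x \<partial>M s) = 0"
    then have "AE x in M s. f x = 0" using integral_nonneg_eq_0_iff_AE[OF int nonneg] by simp
    then have "AE x in M s. x \<notin> - insert 0 Z"
      using AE_M[OF assms(1)] by eventually_elim (use assms(5) in force)
    moreover have "- insert 0 Z \<in> sets (M s)"
      unfolding sets_M[OF assms(1)] using assms(4) by (intro borel_open open_Compl finite_imp_closed) simp
    moreover have "space (M s) = UNIV" using sets_eq_imp_space_eq[OF sets_M[OF assms(1)]] by simp
    ultimately have "emeasure (M s) (- insert 0 Z) = 0"
      by (subst (asm) AE_iff_measurable[where N = "- insert 0 Z"]) (simp_all, blast)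
    then show False using M_cofinite[OF assms(1), of "insert 0 Z"] assms(4) by simp
  qed
  moreover have "(\<integral>x. f x \<partial>M s) \<ge> 0" by (rule integral_nonneg_AE) fact
  ultimately show ?thesis by simp
qed

lemma measurable_line_density:
  "j < p \<Longrightarrow> line_density M s j \<in> borel_measurable borel"
proof (induction "j - s" arbitrary: s)
  case 0
  then have "line_density M s j = (\<lambda>_. 1)" by (auto simp: line_density.simps)
  then show ?case by simp
next
  case (Suc n)
  then have s: "s < j" by simp
  then have [measurable]: "line_density M (Suc s) j \<in> borel_measurable borel"
    using Suc by (intro Suc(1)) auto
  have sp: "Suc s < p" using s Suc by simp
  interpret finite_measure "M (Suc s)" using finite_M sp .
  note [measurable_cong] = sets_M[OF sp]
  have "(\<lambda>x. x * (\<integral>t. line_density M (Suc s) j t / (x - t) \<partial>M (Suc s))) \<in> borel_measurable borel"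
    by measurable
  also have "(\<lambda>x. x * (\<integral>t. line_density M (Suc s) j t / (x - t) \<partial>M (Suc s))) = line_density M s j"
    using s by (auto simp: line_density.simps)
  finally show ?case .
qed

text \<open>Dominated convergence: the kernel is bounded because the two compact intervals have
  positive distance.\<close>

lemma continuous_cauchy_transform:
  assumes s: "Suc s < p" and g [measurable]: "g \<in> borel_measurable borel" and gc: "continuous_on (I (Suc s)) g"
  shows "continuous_on (I s) (\<lambda>x. \<integral>t. g t / (x - t) \<partial>M (Suc s))"
proof -
  note [measurable_cong] = sets_M[OF s]
  interpret finite_measure "M (Suc s)" using finite_M s .
  obtain d where d: "d > 0" "\<And>x t. x \<in> I s \<Longrightarrow> t \<in> I (Suc s) \<Longrightarrow> d \<le> dist x t"
    using separate_compact_closed[of "I s" "I (Suc s)"] disjoint[OF s] by auto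
  have ig: "integrable (M (Suc s)) g" by (rule integrable_M) fact+
  show ?thesis unfolding continuous_on_sequentially
  proof safe
    fix x :: "nat \<Rightarrow> real" and a assume x: "\<forall>n. x n \<in> I s" and a: "a \<in> I s" and lim: "x \<longlonglongrightarrow> a"
    have "(\<lambda>n. \<integral>t. g t / (x n - t) \<partial>M (Suc s)) \<longlonglongrightarrow> (\<integral>t. g t / (a - t) \<partial>M (Suc s))"
    proof (rule integral_dominated_convergence[where w = "\<lambda>t. norm (g t) / d"])
      show "AE t in M (Suc s). (\<lambda>n. g t / (x n - t)) \<longlonglongrightarrow> g t / (a - t)"
        using AE_M[OF s] by eventually_elim (use sep[OF s a] lim in \<open>auto intro!: tendsto_intros\<close>)
      show "AE t in M (Suc s). norm (g t / (x n - t)) \<le> norm (g t) / d" for n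
        using AE_M[OF s]
      proof eventually_elim
        case (elim t)
        then have "d \<le> \<bar>x n - t\<bar>" using d(2)[of "x n" t] x by (auto simp: dist_real_def)
        then show ?case using d(1) by (auto simp: abs_divide intro!: divide_left_mono)
      qed
    qed (use ig in auto)
    then show "((\<lambda>x. \<integral>t. g t / (x - t) \<partial>M (Suc s)) \<circ> x) \<longlonglongrightarrow> (\<integral>t. g t / (a - t) \<partial>M (Suc s))"
      by (simp add: o_def)
  qed
qed

lemma continuous_line_density: "j < p \<Longrightarrow> s < p \<Longrightarrow> continuous_on (I s) (line_density M s j)"
proof (induction "j - s" arbitrary: s)
  case 0
  then have "line_density M s j = (\<lambda>_. 1)" by (auto simp: line_density.simps)
  then show ?case by simp
next
  case (Suc n)
  then have s: "s < j" by simp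
  then have sp: "Suc s < p" using s Suc by simp
  have "continuous_on (I (Suc s)) (line_density M (Suc s) j)" using Suc sp by (intro Suc(1)) auto
  then have "continuous_on (I s) (\<lambda>x. x * (\<integral>t. line_density M (Suc s) j t / (x - t) \<partial>M (Suc s)))"
    by (intro continuous_intros continuous_cauchy_transform sp measurable_line_density Suc.prems)
  then show ?case using s by (simp add: line_density.simps[of M s j, abs_def])
qed

text \<open>At level \<open>s\<close> only the densities with index from \<open>s\<close> to
  \<open>p - 1\<close> remain, so \<open>k\<close> is split modulo \<open>p - s\<close>: the
  quotient is the power of \<open>x\<close>, the remainder selects the density.\<close>

definition u :: "nat \<Rightarrow> nat \<Rightarrow> real \<Rightarrow> real" where
  "u s k x = x ^ (k div (p - s)) * line_density M s (s + k mod (p - s)) x"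

lemma measurable_u [measurable]: "s < p \<Longrightarrow> u s k \<in> borel_measurable borel"
proof -
  assume "s < p"
  then have "s + k mod (p - s) < p" using mod_less_divisor[of "p - s" k] by linarith
  from measurable_line_density[OF this, of s] show ?thesis unfolding u_def[abs_def] by measurable
qed

lemma continuous_u: "s < p \<Longrightarrow> continuous_on (I s) (u s k)"
proof -
  assume "s < p"
  then have "s + k mod (p - s) < p" using mod_less_divisor[of "p - s" k] by linarith
  from continuous_line_density[OF this \<open>s < p\<close>] show ?thesis unfolding u_def[abs_def]
    by (intro continuous_intros)
qed

end

subsection \<open>Sign patterns\<close>

text \<open>This counts the indices below \<open>K\<close> that \<open>P\<close> does not divide:
  \<open>P - 1\<close> in each full block, and in the last block all but its first element. The
  truncated subtraction covers an empty last block.\<close>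

definition nonmultiples :: "nat \<Rightarrow> nat \<Rightarrow> nat" where
  "nonmultiples P K = K div P * (P - 1) + (K mod P - 1)"

text \<open>The second summand is \<open>K / P\<close> rounded up, which is the number of multiples
  of \<open>P\<close> below \<open>K\<close>.\<close>

lemma nonmultiples_add:
  assumes "P \<ge> 1"
  shows "nonmultiples P K + (if P dvd K then K div P else Suc (K div P)) = K"
proof -
  obtain P' where P': "P = Suc P'" using assms by (cases P) auto
  have "K div P * P + K mod P = K" by simp
  then have "K div P * P' + K div P + K mod P = K" unfolding P' by (simp add: algebra_simps)
  moreover have "P dvd K \<longleftrightarrow> K mod P = 0" by (simp add: dvd_eq_mod_eq_0)
  ultimately show ?thesis unfolding nonmultiples_def P' by auto
qed

lemma nonmultiples_Suc:
  assumes "P \<ge> 1"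
  shows "nonmultiples P (Suc K) = nonmultiples P K + (if P dvd K then 0 else 1)"
proof -
  have a: "P dvd n \<longleftrightarrow> n mod P = 0" for n by (simp add: dvd_eq_mod_eq_0)
  have "Suc K div P = (if P dvd Suc K then Suc (K div P) else K div P)"
    by (auto simp: div_Suc a)
  moreover have "P dvd K \<Longrightarrow> P dvd Suc K \<Longrightarrow> P = 1"
    by (metis Suc_eq_plus1 dvd_add_right_iff nat_dvd_1_iff_1)
  ultimately show ?thesis
    using nonmultiples_add[OF assms, of K] nonmultiples_add[OF assms, of "Suc K"]
    by (auto split: if_splits)
qed

lemma nonmultiples_0 [simp]: "nonmultiples P 0 = 0"
  by (simp add: nonmultiples_def)

lemma nonmultiples_small:
  assumes "P \<ge> 1" "c \<le> P"
  shows "nonmultiples P c = c - 1"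
  using assms by (cases "c = P") (auto simp: nonmultiples_def)

lemma nonmultiples_shift: "P \<ge> 1 \<Longrightarrow> nonmultiples P (P + K) = P - 1 + nonmultiples P K"
  by (simp add: nonmultiples_def)

lemma nonmultiples_range:
  assumes "P \<ge> 1"
  shows "nonmultiples P c \<le> nonmultiples P (c + d)" "nonmultiples P (c + d) - nonmultiples P c \<le> d"
proof -
  have "nonmultiples P c \<le> nonmultiples P (c + d) \<and> nonmultiples P (c + d) \<le> nonmultiples P c + d"
    by (induction d) (auto simp: nonmultiples_Suc[OF assms])
  then show "nonmultiples P c \<le> nonmultiples P (c + d)" "nonmultiples P (c + d) - nonmultiples P c \<le> d"
    by auto
qed

text \<open>The sign at the right end of a combination of \<open>u\<^sub>c, \<dots>, u\<^bsub>c+d\<^esub>\<close> that has \<open>d\<close> zeros and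
  positive last coefficient, when \<open>P\<close> functions remain and the interval lies on the side of
  \<open>0\<close> given by the sign \<open>e\<close>. Indices divisible by \<open>P\<close> are pure powers; the \<open>B\<close> other ones come
  from the next level, where the side is reversed.\<close>

fun sign_pattern :: "nat \<Rightarrow> real \<Rightarrow> nat \<Rightarrow> nat \<Rightarrow> real" where
  "sign_pattern 0 e c d = 1"
| "sign_pattern (Suc P) e c d =
     (let B = nonmultiples (Suc P) (Suc (c + d)) - nonmultiples (Suc P) c
      in e ^ B * (if Suc P dvd c + d then 1
                  else (- e) ^ d * sign_pattern P (- e) (if c = 0 then P else c - 1) (B - 1))
              * (if c = 0 then 1 else e))"

declare sign_pattern.simps(2) [simp del]

lemma sign_pattern_cases: "e = 1 \<or> e = -1 \<Longrightarrow> sign_pattern P e c d = 1 \<or> sign_pattern P e c d = -1"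
proof (induction P arbitrary: e c d)
  case (Suc P)
  have pow: "x ^ n = 1 \<or> x ^ n = -1" if "x = 1 \<or> x = -1" for x :: real and n
    using that by (cases "even n") auto
  have "- e = 1 \<or> - e = -1" using Suc.prems by auto
  then have IH: "sign_pattern P (- e) c' d' = 1 \<or> sign_pattern P (- e) c' d' = -1" for c' d' by (rule Suc.IH)
  have mult: "x * y = 1 \<or> x * y = -1" if "x = 1 \<or> x = -1" "y = 1 \<or> y = -1" for x y :: real
    using that by auto
  have ite: "(if b then x else y) = 1 \<or> (if b then x else y) = -1"
    if "x = 1 \<or> x = -1" "y = 1 \<or> y = -1" for b and x y :: real
    using that by auto
  show ?case unfolding sign_pattern.simps Let_def
    by (intro mult pow ite IH) (use Suc.prems in auto)
qed simp

text \<open>Behind this is \<open>u s (P + k) x = x * u s k x\<close> for \<open>P = p - s\<close>.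
  In the recursion, the divisibility test, \<open>B\<close> and the start at the next level agree
  for \<open>c = P\<close> and \<open>c = 0\<close>; only the final factor differs.\<close>

lemma sign_pattern_wrap:
  assumes "P \<ge> 1"
  shows "sign_pattern P e P d = e * sign_pattern P e 0 d"
proof -
  obtain P' where P: "P = Suc P'" using assms by (cases P) auto
  have "nonmultiples P (Suc (P + d)) - nonmultiples P P = nonmultiples P (Suc d)"
    using nonmultiples_shift[OF assms, of "Suc d"] nonmultiples_shift[OF assms, of 0] by simp
  moreover have "P dvd P + d \<longleftrightarrow> P dvd d" by simp
  ultimately show ?thesis unfolding P sign_pattern.simps Let_def by simp
qed

text \<open>Both patterns end at the same index \<open>c + d + 1\<close>, so they fall into the same
  case of the recursion. At the next level the same comparison recurs if \<open>c > 0\<close>, while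
  \<open>c = 0\<close> leads to the wrap identity. The resulting \<open>- e\<close> meets the
  \<open>- e\<close> left over from the powers with exponents \<open>d + 1\<close> and
  \<open>d\<close>.\<close>

lemma sign_pattern_step:
  assumes "e = 1 \<or> e = -1" "c < P"
  shows "sign_pattern P e c (Suc d) * sign_pattern P e (Suc c) d = e"
  using assms
proof (induction P arbitrary: e c d)
  case (Suc P)
  let ?N = "nonmultiples (Suc P)"
  define B where "B = ?N (Suc (Suc (c + d))) - ?N c"
  define B2 where "B2 = ?N (Suc (Suc (c + d))) - ?N (Suc c)"
  have ee: "e * e = 1" "e * (e * y) = y" for y using Suc.prems by auto
  have sq: "x * x = 1" if "x = 1 \<or> x = -1" for x :: real using that by auto
  have dvd: "Suc P dvd c \<longleftrightarrow> c = 0" using Suc.prems by (auto dest: dvd_imp_le)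
  have Nc: "?N (Suc c) = ?N c + (if c = 0 then 0 else 1)"
    using nonmultiples_Suc[of "Suc P" c] dvd by simp
  have le: "?N (Suc c) \<le> ?N (Suc (c + d))" using nonmultiples_range(1)[of "Suc P" "Suc c" d] by simp
  have NS: "?N (Suc (Suc (c + d))) = ?N (Suc (c + d)) + (if Suc P dvd Suc (c + d) then 0 else 1)"
    by (rule nonmultiples_Suc) simp
  have BB: "B = (if c = 0 then B2 else Suc B2)" using Nc le NS by (auto simp: B_def B2_def)
  have B2_pos: "B2 \<ge> 1" if "\<not> Suc P dvd Suc (c + d)" using that le NS by (simp add: B2_def)
  have ebe: "e ^ n * e ^ n = 1" "(-e) ^ n * (-e) ^ n = 1" for n
    using ee(1) by (simp_all flip: power_mult_distrib)
  have e1: "sign_pattern (Suc P) e c (Suc d) = e ^ B * (if Suc P dvd Suc (c + d) then 1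
      else (- e) ^ Suc d * sign_pattern P (- e) (if c = 0 then P else c - 1) (B - 1)) * (if c = 0 then 1 else e)"
    by (simp add: sign_pattern.simps Let_def B_def)
  have e2: "sign_pattern (Suc P) e (Suc c) d = e ^ B2 * (if Suc P dvd Suc (c + d) then 1
      else (- e) ^ d * sign_pattern P (- e) c (B2 - 1)) * e"
    by (simp add: sign_pattern.simps Let_def B2_def)
  have eB: "e ^ B * (if c = 0 then 1 else e) * e ^ B2 * e = e"
    using ebe(1)[of B2] ee by (auto simp: BB algebra_simps)
  show ?case
  proof (cases "Suc P dvd Suc (c + d)")
    case True
    then show ?thesis unfolding e1 e2 using eB by (simp add: algebra_simps)
  next
    case False
    have "sign_pattern P (- e) (if c = 0 then P else c - 1) (B - 1) * sign_pattern P (- e) c (B2 - 1) = - e"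
    proof (cases "c = 0")
      case True
      have "P \<ge> 1" using False by (cases P) auto
      have "sign_pattern P (- e) 0 (B2 - 1) * sign_pattern P (- e) 0 (B2 - 1) = 1"
        by (rule sq, rule sign_pattern_cases) (use Suc.prems in auto)
      then show ?thesis using True BB by (simp add: sign_pattern_wrap[OF \<open>P \<ge> 1\<close>] mult.assoc)
    next
      case c: False
      have "B - 1 = Suc (B2 - 1)" using BB c B2_pos[OF False] by simp
      moreover have "sign_pattern P (- e) (c - 1) (Suc (B2 - 1)) * sign_pattern P (- e) (Suc (c - 1)) (B2 - 1) = - e"
        by (rule Suc.IH) (use Suc.prems c in auto)
      ultimately show ?thesis using c by simp
    qed
    moreover have "sign_pattern (Suc P) e c (Suc d) * sign_pattern (Suc P) e (Suc c) d =
      (e ^ B * (if c = 0 then 1 else e) * e ^ B2 * e) * ((-e) ^ d * (-e) ^ d) * (- e) *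
      (sign_pattern P (- e) (if c = 0 then P else c - 1) (B - 1) * sign_pattern P (- e) c (B2 - 1))"
      unfolding e1 e2 if_not_P[OF False] power_Suc by (simp only: ac_simps)
    ultimately show ?thesis unfolding eB ebe by (simp add: ee)
  qed
qed simp

section \<open>Splitting combinations into a polynomial and a Cauchy transform\<close>

context line_nikishin begin

lemma integrable_cauchy:
  assumes "Suc s < p" "x \<in> I s" "h \<in> borel_measurable borel" "continuous_on (I (Suc s)) h"
  shows "integrable (M (Suc s)) (\<lambda>t. h t / (x - t))"
proof (rule integrable_M[OF assms(1)])
  show "(\<lambda>t. h t / (x - t)) \<in> borel_measurable borel" using assms(3) by measurable
  show "continuous_on (I (Suc s)) (\<lambda>t. h t / (x - t))"
    by (intro continuous_intros assms(4)) (use sep[OF assms(1,2)] in auto)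
qed

text \<open>Since \<open>(x ^ e - t ^ e) / (x - t)\<close> is a polynomial in \<open>x\<close> and
  \<open>t\<close>, exchanging \<open>x ^ e\<close> for \<open>t ^ e\<close> costs a polynomial in
  \<open>x\<close> of degree below \<open>e\<close> whose coefficients are moments of
  \<open>g\<close>.\<close>

lemma power_times_cauchy:
  assumes s: "Suc s < p" and x: "x \<in> I s" and g [measurable]: "g \<in> borel_measurable borel"
    and gc: "continuous_on (I (Suc s)) g"
  shows "x ^ e * (\<integral>t. g t / (x - t) \<partial>M (Suc s)) =
    poly (\<Sum>a<e. monom (\<integral>t. t ^ (e - Suc a) * g t \<partial>M (Suc s)) a) x + (\<integral>t. t ^ e * g t / (x - t) \<partial>M (Suc s))"
proof -
  note [measurable_cong] = sets_M[OF s]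
  have int: "integrable (M (Suc s)) (\<lambda>t. t ^ n * g t)" for n
    by (rule integrable_M[OF s]) (auto intro!: continuous_intros gc)
  have "x ^ e * (\<integral>t. g t / (x - t) \<partial>M (Suc s)) = (\<integral>t. x ^ e * (g t / (x - t)) \<partial>M (Suc s))"
    by (simp del: times_divide_eq_right)
  also have "\<dots> = (\<integral>t. (\<Sum>a<e. x ^ a * (t ^ (e - Suc a) * g t)) + t ^ e * g t / (x - t) \<partial>M (Suc s))"
  proof (rule integral_cong_AE)
    show "AE t in M (Suc s). x ^ e * (g t / (x - t)) =
      (\<Sum>a<e. x ^ a * (t ^ (e - Suc a) * g t)) + t ^ e * g t / (x - t)"
      using AE_M[OF s]
    proof eventually_elim
      case (elim t)
      then have "x - t \<noteq> 0" using sep[OF s x] by auto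
      have "x ^ e - t ^ e = (x - t) * (\<Sum>a<e. t ^ (e - Suc a) * x ^ a)"
        by (rule power_diff_sumr2[of x e t])
      then have "x ^ e = (x - t) * (\<Sum>a<e. t ^ (e - Suc a) * x ^ a) + t ^ e" by simp
      then have "x ^ e * (g t / (x - t)) = ((x - t) * (\<Sum>a<e. t ^ (e - Suc a) * x ^ a) + t ^ e) * (g t / (x - t))"
        by (simp only:)
      also have "\<dots> = (x - t) * (g t / (x - t)) * (\<Sum>a<e. t ^ (e - Suc a) * x ^ a) + t ^ e * (g t / (x - t))"
        by (simp only: distrib_right) (simp only: mult_ac)
      also have "(x - t) * (g t / (x - t)) = g t" using \<open>x - t \<noteq> 0\<close> by simp
      also have "g t * (\<Sum>a<e. t ^ (e - Suc a) * x ^ a) = (\<Sum>a<e. x ^ a * (t ^ (e - Suc a) * g t))"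
        unfolding sum_distrib_left by (rule sum.cong) (simp_all only: mult_ac)
      finally show ?case by simp
    qed
  qed measurable
  also have "\<dots> = (\<Sum>a<e. x ^ a * (\<integral>t. t ^ (e - Suc a) * g t \<partial>M (Suc s))) + (\<integral>t. t ^ e * g t / (x - t) \<partial>M (Suc s))"
  proof (subst Bochner_Integration.integral_add)
    show "integrable (M (Suc s)) (\<lambda>t. \<Sum>a<e. x ^ a * (t ^ (e - Suc a) * g t))"
      by (intro Bochner_Integration.integrable_sum integrable_mult_right int)
    show "integrable (M (Suc s)) (\<lambda>t. t ^ e * g t / (x - t))"
      by (intro integrable_cauchy s x continuous_intros gc) simp
    have "(\<integral>t. (\<Sum>a<e. x ^ a * (t ^ (e - Suc a) * g t)) \<partial>M (Suc s)) =
      (\<Sum>a<e. \<integral>t. x ^ a * (t ^ (e - Suc a) * g t) \<partial>M (Suc s))"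
      by (rule Bochner_Integration.integral_sum) (intro integrable_mult_right int)
    then show "(\<integral>t. (\<Sum>a<e. x ^ a * (t ^ (e - Suc a) * g t)) \<partial>M (Suc s)) +
        (\<integral>t. t ^ e * g t / (x - t) \<partial>M (Suc s)) =
      (\<Sum>a<e. x ^ a * (\<integral>t. t ^ (e - Suc a) * g t \<partial>M (Suc s))) + (\<integral>t. t ^ e * g t / (x - t) \<partial>M (Suc s))"
      by simp
  qed
  finally show ?thesis by (simp add: poly_sum poly_monom mult.commute)
qed

lemma u_multiple: "p - s dvd k \<Longrightarrow> u s k x = x ^ (k div (p - s))"
  by (simp add: u_def line_density.simps dvd_eq_mod_eq_0)

lemma u_nonmultiple:
  assumes "\<not> p - s dvd k"
  shows "u s k x = x ^ Suc (k div (p - s)) *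
    (\<integral>t. line_density M (Suc s) (s + k mod (p - s)) t / (x - t) \<partial>M (Suc s))"
proof -
  have "s < s + k mod (p - s)" using assms by (simp add: dvd_eq_mod_eq_0)
  then show ?thesis unfolding u_def line_density.simps[of M s] by simp
qed

lemma u_Suc_level:
  assumes "0 < j" "j < p - s"
  shows "u (Suc s) (i * (p - s - 1) + (j - 1)) t = t ^ i * line_density M (Suc s) (s + j) t"
proof -
  obtain k where "j = Suc k" using assms(1) by (cases j) auto
  moreover obtain q where "p - s = Suc q" "p - Suc s = q" using assms by (cases "p - s") auto
  ultimately show ?thesis using assms(2) by (simp add: u_def)
qed

text \<open>The factor \<open>x ^ i\<close> of a Cauchy transform is moved under the integral sign at the cost of
  lower powers of \<open>x\<close>, which are already among the preceding functions of the sequence.\<close>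

lemma combination_decomposition:
  fixes c d :: nat and lam :: "nat \<Rightarrow> real"
  assumes s: "Suc s < p" and c: "c \<le> p - s"
  defines "B \<equiv> \<lambda>d. nonmultiples (p - s) (c + d) - nonmultiples (p - s) c"
    and "c' \<equiv> if c = 0 then p - s - 1 else c - 1"
  shows "\<exists>r \<mu>. (\<forall>i \<ge> d - B d. coeff r i = 0) \<and>
    (\<forall>d'. d = Suc d' \<longrightarrow> (if p - s dvd c + d' then coeff r (d - B d - 1) = lam d' else \<mu> (B d - 1) = lam d')) \<and>
    (\<forall>x\<in>I s. (\<Sum>k<d. lam k * u s (c + k) x) = x ^ (if c = 0 then 0 else 1) *
       (poly r x + (\<integral>t. (\<Sum>b<B d. \<mu> b * u (Suc s) (c' + b) t) / (x - t) \<partial>M (Suc s))))"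
proof (induction d)
  case 0
  show ?case by (intro exI[of _ 0] exI[of _ "\<lambda>_. 0"]) (auto simp: B_def)
next
  case (Suc d)
  define P where "P = p - s"
  have P: "P \<ge> 1" using s by (simp add: P_def)
  \<comment> \<open>If \<open>c > 0\<close>, every function of the block contains a factor
    \<open>x\<close>, which is pulled out; the next level then starts at \<open>c - 1\<close>. If
    \<open>c = 0\<close>, the function 1 occurs and nothing can be pulled out, so one more power
    goes under the integral and the next level starts one full period later, at
    \<open>p - s - 1\<close>.\<close>
  define \<delta> :: nat where "\<delta> = (if c = 0 then 0 else 1)"
  define A where "A = d - B d"
  obtain r \<mu> where r: "\<And>i. i \<ge> A \<Longrightarrow> coeff r i = 0" and
    F: "\<And>x. x \<in> I s \<Longrightarrow> (\<Sum>k<d. lam k * u s (c + k) x) = x ^ \<delta> *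
       (poly r x + (\<integral>t. (\<Sum>b<B d. \<mu> b * u (Suc s) (c' + b) t) / (x - t) \<partial>M (Suc s)))"
    using Suc unfolding A_def \<delta>_def by blast
  have Bd: "B d \<le> d" "nonmultiples P (c + d) = nonmultiples P c + B d"
    using nonmultiples_range[OF P, of c d] by (auto simp: B_def P_def)
  have Nc: "nonmultiples P c + \<delta> = c" using nonmultiples_small[OF P] c by (auto simp: \<delta>_def P_def)
  \<comment> \<open>After \<open>x ^ \<delta>\<close> is removed, the new function carries exactly
    the exponent \<open>A\<close>, the current bound on the number of coefficients of
    \<open>r\<close>. Hence a pure power extends \<open>r\<close> by one coefficient, and the debris
    of a Cauchy transform fits below it.\<close>
  have A_eq: "\<delta> + A = (if P dvd c + d then (c + d) div P else Suc ((c + d) div P))"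
    using nonmultiples_add[OF P, of "c + d"] Bd Nc unfolding A_def by linarith
  have BS: "B (Suc d) = (if P dvd c + d then B d else Suc (B d))"
    using nonmultiples_Suc[OF P, of "c + d"] nonmultiples_range(1)[OF P, of c d]
    by (simp add: B_def P_def Suc_diff_le)
  show ?case
  proof (cases "P dvd c + d")
    case True
    have As: "Suc d - B (Suc d) = Suc A" using BS True Bd by (simp add: A_def)
    show ?thesis unfolding As
    proof (intro exI[of _ "r + monom (lam d) A"] exI[of _ \<mu>] conjI ballI allI impI)
      fix x assume x: "x \<in> I s"
      have "u s (c + d) x = x ^ \<delta> * x ^ A"
        using u_multiple[of s "c + d" x] True A_eq by (simp add: P_def flip: power_add)
      then show "(\<Sum>k<Suc d. lam k * u s (c + k) x) = x ^ (if c = 0 then 0 else 1) *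
       (poly (r + monom (lam d) A) x + (\<integral>t. (\<Sum>b<B (Suc d). \<mu> b * u (Suc s) (c' + b) t) / (x - t) \<partial>M (Suc s)))"
        using F[OF x] BS True by (simp add: poly_monom algebra_simps flip: \<delta>_def)
    qed (use r True in \<open>auto simp: P_def\<close>)
  next
    case False
    have As: "Suc d - B (Suc d) = A" using BS False Bd by (simp add: A_def)
    define i where "i = (c + d) div P"
    define j where "j = (c + d) mod P"
    have j: "0 < j" "j < P" using False P by (auto simp: j_def dvd_eq_mod_eq_0)
    define g where "g = line_density M (Suc s) (s + j)"
    have "s + j < p" using j by (simp add: P_def)
    then have g: "g \<in> borel_measurable borel" "continuous_on (I (Suc s)) g"
      unfolding g_def using measurable_line_density continuous_line_density s by auto
    \<comment> \<open>The lower powers released when \<open>x ^ A\<close> moves under the integral;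
      they leave the coefficients from \<open>A\<close> on at zero.\<close>
    define q where "q = (\<Sum>a<A. monom (\<integral>t. t ^ (A - Suc a) * g t \<partial>M (Suc s)) a)"
    define \<mu>' where "\<mu>' = \<mu>(B d := lam d)"
    \<comment> \<open>The \<open>B d\<close> indices used so far are consecutive at the next level,
      and this new function is the next in line there.\<close>
    have idx: "c' + B d = A * (P - 1) + (j - 1)"
    proof -
      have *: "nonmultiples P (c + d) = i * (P - 1) + (j - 1)" by (simp add: nonmultiples_def i_def j_def)
      show ?thesis
      proof (cases "c = 0")
        case True
        then have "A = Suc i" using A_eq False by (simp add: \<delta>_def i_def)
        moreover have "B d = i * (P - 1) + (j - 1)" using * Bd True by simp
        ultimately show ?thesis using True by (simp add: c'_def P_def)
      next
        case c: False
        then have "A = i" using A_eq False by (simp add: \<delta>_def i_def)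
        moreover have "c' + B d = i * (P - 1) + (j - 1)" using * Bd c Nc by (simp add: c'_def \<delta>_def)
        ultimately show ?thesis by simp
      qed
    qed
    have g_u: "t ^ A * g t = u (Suc s) (c' + B d) t" for t
      using u_Suc_level[of j s A t] j unfolding idx g_def by (simp add: P_def)
    have qz: "coeff q i = 0" if "i \<ge> A" for i
      using that by (auto simp: q_def coeff_sum intro!: sum.neutral)
    show ?thesis unfolding As
    proof (intro exI[of _ "r + smult (lam d) q"] exI[of _ \<mu>'] conjI ballI allI impI)
      fix x assume x: "x \<in> I s"
      have "u s (c + d) x = x ^ Suc i * (\<integral>t. g t / (x - t) \<partial>M (Suc s))"
        using u_nonmultiple[of s "c + d" x] False by (simp add: P_def i_def j_def g_def)
      also have "x ^ Suc i = x ^ \<delta> * x ^ A" using A_eq False by (simp add: i_def flip: power_add power_Suc)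
      also have "x ^ \<delta> * x ^ A * (\<integral>t. g t / (x - t) \<partial>M (Suc s)) =
          x ^ \<delta> * (poly q x + (\<integral>t. u (Suc s) (c' + B d) t / (x - t) \<partial>M (Suc s)))"
        using power_times_cauchy[OF s x g, of A] by (simp add: q_def g_u mult.assoc)
      finally have ux: "u s (c + d) x =
        x ^ \<delta> * (poly q x + (\<integral>t. u (Suc s) (c' + B d) t / (x - t) \<partial>M (Suc s)))" .
      have "(\<integral>t. (\<Sum>b<B (Suc d). \<mu>' b * u (Suc s) (c' + b) t) / (x - t) \<partial>M (Suc s)) =
        (\<integral>t. (\<Sum>b<B d. \<mu> b * u (Suc s) (c' + b) t) / (x - t) + lam d * (u (Suc s) (c' + B d) t / (x - t)) \<partial>M (Suc s))"
        using BS False by (simp add: \<mu>'_def add_divide_distrib)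
      also have "\<dots> = (\<integral>t. (\<Sum>b<B d. \<mu> b * u (Suc s) (c' + b) t) / (x - t) \<partial>M (Suc s)) +
          lam d * (\<integral>t. u (Suc s) (c' + B d) t / (x - t) \<partial>M (Suc s))"
      proof (subst Bochner_Integration.integral_add)
        show "integrable (M (Suc s)) (\<lambda>t. (\<Sum>b<B d. \<mu> b * u (Suc s) (c' + b) t) / (x - t))"
          using s by (intro integrable_cauchy x) (auto intro!: continuous_intros continuous_u)
        show "integrable (M (Suc s)) (\<lambda>t. lam d * (u (Suc s) (c' + B d) t / (x - t)))"
          using s by (intro integrable_mult_right integrable_cauchy x) (auto intro!: continuous_u)
      qed (simp del: times_divide_eq_right)
      finally show "(\<Sum>k<Suc d. lam k * u s (c + k) x) = x ^ (if c = 0 then 0 else 1) *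
       (poly (r + smult (lam d) q) x + (\<integral>t. (\<Sum>b<B (Suc d). \<mu>' b * u (Suc s) (c' + b) t) / (x - t) \<partial>M (Suc s)))"
        using F[OF x] ux by (simp add: algebra_simps flip: \<delta>_def)
    qed (use r qz False BS in \<open>auto simp: P_def \<mu>'_def\<close>)
  qed
qed

text \<open>Take the divided difference of \<open>F * g\<close> at the nodes
  \<open>insert x S\<close>, where \<open>F\<close> is \<open>r\<close> plus the Cauchy transform of
  \<open>G\<close>. As \<open>F\<close> vanishes on \<open>S\<close>, only the node \<open>x\<close>
  contributes; on the other side the polynomial part gives a top coefficient and each kernel is
  handled by \<open>sum_divided_cauchy\<close>.\<close>

lemma interpolation_identity:
  assumes s: "Suc s < p" and S: "finite S" "card S = d" "S \<subseteq> I s" and x: "x \<in> I s" "x \<notin> S"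
    and G [measurable]: "G \<in> borel_measurable borel" and Gc: "continuous_on (I (Suc s)) G"
    and deg: "degree g \<le> d" "degree (r * g) \<le> d"
    and zero: "\<And>y. y \<in> S \<Longrightarrow> poly r y + (\<integral>t. G t / (y - t) \<partial>M (Suc s)) = 0"
  shows "(poly r x + (\<integral>t. G t / (x - t) \<partial>M (Suc s))) * poly g x / (\<Prod>y\<in>S. x - y) =
    coeff (r * g) d + (\<integral>t. poly g t * G t / ((\<Prod>y\<in>S. t - y) * (x - t)) \<partial>M (Suc s))"
proof -
  note [measurable_cong] = sets_M[OF s]
  define X where "X = insert x S"
  have X: "finite X" "card X = Suc d" "X \<subseteq> I s" using S x by (auto simp: X_def)
  define w where "w y = (\<Prod>z\<in>X - {y}. y - z)" for y
  have wx: "w x = (\<Prod>y\<in>S. x - y)" using x by (simp add: w_def X_def)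
  have [measurable]: "poly g \<in> borel_measurable borel"
    by (intro borel_measurable_continuous_onI continuous_intros)
  have [measurable]: "(\<lambda>t. \<Prod>y\<in>S. t - y) \<in> borel_measurable borel"
    by (intro borel_measurable_prod) simp
  define F where "F y = poly r y + (\<integral>t. G t / (y - t) \<partial>M (Suc s))" for y
  have "F x * poly g x / w x = (\<Sum>y\<in>X. F y * poly g y / w y)"
    using zero S x by (simp add: X_def F_def)
  also have "\<dots> = (\<Sum>y\<in>X. poly (r * g) y / w y) + (\<Sum>y\<in>X. poly g y / w y * (\<integral>t. G t / (y - t) \<partial>M (Suc s)))"
    by (simp add: F_def algebra_simps add_divide_distrib sum.distrib)
  also have "(\<Sum>y\<in>X. poly (r * g) y / w y) = coeff (r * g) d"
    unfolding w_def by (rule coeff_eq_sum_divided) (use X deg in auto)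
  also have "(\<Sum>y\<in>X. poly g y / w y * (\<integral>t. G t / (y - t) \<partial>M (Suc s))) =
      (\<integral>t. (\<Sum>y\<in>X. poly g y / w y * (G t / (y - t))) \<partial>M (Suc s))"
    by (subst Bochner_Integration.integral_sum) (use X s Gc in \<open>auto intro!: integrable_mult_right integrable_cauchy simp del: times_divide_eq_right times_divide_times_eq\<close>)
  also have "\<dots> = (\<integral>t. poly g t * G t / ((\<Prod>y\<in>S. t - y) * (x - t)) \<partial>M (Suc s))"
  proof (rule integral_cong_AE)
    show "AE t in M (Suc s). (\<Sum>y\<in>X. poly g y / w y * (G t / (y - t))) =
        poly g t * G t / ((\<Prod>y\<in>S. t - y) * (x - t))"
      using AE_M[OF s]
    proof eventually_elim
      case (elim t)
      then have t: "t \<notin> X" using sep[OF s] X by blast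
      have "(\<Sum>y\<in>X. poly g y / w y * (G t / (y - t))) = G t * (\<Sum>y\<in>X. poly g y / (y - t) / w y)"
        by (simp add: sum_distrib_left mult_ac)
      also have "\<dots> = G t * (- poly g t / (\<Prod>y\<in>X. t - y))"
        unfolding w_def using sum_divided_cauchy[OF X(1,2) deg(1) t] by simp
      also have "(\<Prod>y\<in>X. t - y) = - ((\<Prod>y\<in>S. t - y) * (x - t))"
        using S x by (simp add: X_def algebra_simps)
      finally show ?case by simp
    qed
  qed measurable
  finally show ?thesis unfolding wx F_def .
qed

end

subsection \<open>The oriented Chebyshev property\<close>

text \<open>The condition on the coefficients expresses \<open>degree r < A\<close> in a form that
  also covers \<open>A = 0\<close>, where \<open>r\<close> is zero.\<close>

lemma coeff_mult_eq_0:
  fixes r g :: "'a::comm_semiring_0 poly"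
  assumes "\<And>i. i \<ge> A \<Longrightarrow> coeff r i = 0" "A + degree g \<le> n"
  shows "coeff (r * g) n = 0"
  unfolding coeff_mult
proof (rule sum.neutral, rule ballI)
  fix i assume "i \<in> {..n}"
  then have "A \<le> i \<or> degree g < n - i" using assms(2) by auto
  then show "coeff r i * coeff g (n - i) = 0" using assms(1) by (auto simp: coeff_eq_0)
qed

lemma prod_linear_poly:
  fixes S :: "'a::field set"
  assumes "finite S"
  shows "degree (\<Prod>y\<in>S. [:-y, 1:]) = card S" "lead_coeff (\<Prod>y\<in>S. [:-y, 1:]) = 1"
    "poly (\<Prod>y\<in>S. [:-y, 1:]) x = (\<Prod>y\<in>S. x - y)"
  using lead_coeff_prod[of "\<lambda>y. [:-y, 1:]" S] by (auto simp: degree_prod_eq_sum_degree poly_prod)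

context line_nikishin begin

abbreviation (input) comb :: "nat \<Rightarrow> nat \<Rightarrow> (nat \<Rightarrow> real) \<Rightarrow> nat \<Rightarrow> real \<Rightarrow> real" where
  "comb s c lam d x \<equiv> \<Sum>k\<le>d. lam k * u s (c + k) x"

definition R :: "nat \<Rightarrow> nat \<Rightarrow> nat \<Rightarrow> real" where
  "R s c d = sign_pattern (p - s) (\<eta> s) c d"

lemma R_cases: "R s c d = 1 \<or> R s c d = -1"
  unfolding R_def by (rule sign_pattern_cases) (rule eta_cases)

text \<open>The product over \<open>S\<close> transports the sign at the right end to every other
  point and says that each prescribed zero is a sign change. The start \<open>c = p - s\<close> is
  included because the descent from \<open>c = 0\<close> one level above begins there; at level 0 it
  is the residue \<open>p\<close>.\<close>

definition oriented_chebyshev :: "nat \<Rightarrow> bool" where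
  "oriented_chebyshev s \<longleftrightarrow> (\<forall>c\<le>p - s. \<forall>d lam S. finite S \<longrightarrow> card S = d \<longrightarrow> S \<subseteq> J s \<longrightarrow> lam d > 0 \<longrightarrow>
     (\<forall>y\<in>S. comb s c lam d y = 0) \<longrightarrow>
     (\<forall>x\<in>J s - S. R s c d * (\<Prod>y\<in>S. x - y) * comb s c lam d x > 0))"

lemma oriented_chebyshevD:
  assumes "oriented_chebyshev s" "c \<le> p - s" "finite S" "card S = d" "S \<subseteq> J s" "lam d > 0"
    "\<And>y. y \<in> S \<Longrightarrow> comb s c lam d y = 0" "x \<in> J s" "x \<notin> S"
  shows "R s c d * (\<Prod>y\<in>S. x - y) * comb s c lam d x > 0"
  using assms unfolding oriented_chebyshev_def by blast

text \<open>Truncate at the last nonzero coefficient \<open>e\<close> and make it positive. With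
  \<open>e + 1\<close> zeros, \<open>e\<close> of them prescribed as \<open>S\<close> would give the
  remaining one a strict sign.\<close>

lemma comb_zeros:
  assumes "oriented_chebyshev s" "c \<le> p - s" "\<exists>k\<le>d. lam k \<noteq> 0"
  shows "finite {x\<in>J s. comb s c lam d x = 0}" "card {x\<in>J s. comb s c lam d x = 0} \<le> d"
proof -
  define Z where "Z = {x\<in>J s. comb s c lam d x = 0}"
  define e where "e = Max {k. k \<le> d \<and> lam k \<noteq> 0}"
  have e: "e \<le> d" "lam e \<noteq> 0" "\<And>k. k \<le> d \<Longrightarrow> lam k \<noteq> 0 \<Longrightarrow> k \<le> e"
    using Max_in[of "{k. k \<le> d \<and> lam k \<noteq> 0}"] assms(3) by (auto simp: e_def)
  have comb: "comb s c lam d x = comb s c lam e x" for x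
  proof (rule sum.mono_neutral_right)
    show "\<forall>k\<in>{..d} - {..e}. lam k * u s (c + k) x = 0"
    proof
      fix k assume "k \<in> {..d} - {..e}"
      then have "lam k = 0" using e(3)[of k] by (meson Diff_iff atMost_iff)
      then show "lam k * u s (c + k) x = 0" by simp
    qed
  qed (use e(1) in auto)
  have "\<not> (infinite Z \<or> card Z > d)"
  proof
    assume "infinite Z \<or> card Z > d"
    then obtain T where T: "T \<subseteq> Z" "finite T" "card T = Suc e"
      using infinite_arbitrarily_large[of Z "Suc e"] obtain_subset_with_card_n[of "Suc e" Z] e(1)
      by (metis Suc_le_eq finite_subset le_less_trans)
    then obtain x S where xS: "T = insert x S" "x \<notin> S" "card S = e"
      by (metis card_Suc_eq)
    have S: "finite S" "S \<subseteq> J s" "x \<in> J s" using T xS by (auto simp: Z_def)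
    have z: "comb s c lam e y = 0" if "y \<in> insert x S" for y
      using that T(1) xS(1) comb by (auto simp: Z_def)
    define \<nu> where "\<nu> k = sgn (lam e) * lam k" for k
    have \<nu>: "comb s c \<nu> e y = sgn (lam e) * comb s c lam e y" for y
      by (simp add: \<nu>_def sum_distrib_left mult.assoc)
    have "\<nu> e > 0" using e(2) by (simp add: \<nu>_def sgn_real_def)
    from oriented_chebyshevD[of s c S e \<nu> x, OF assms(1,2) S(1) xS(3) S(2) this _ S(3) xS(2)]
    show False unfolding \<nu> using z by simp
  qed
  then show "finite {x\<in>J s. comb s c lam d x = 0}" "card {x\<in>J s. comb s c lam d x = 0} \<le> d"
    unfolding Z_def by auto
qed

text \<open>There is one unknown more than there are equations. The top coefficient of a solution is
  nonzero, as otherwise a shorter nontrivial combination would have too many zeros; so it can be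
  scaled to 1.\<close>

lemma comb_interpolation:
  assumes "oriented_chebyshev s" "c \<le> p - s" "finite S" "S \<subseteq> J s"
  shows "\<exists>lam. lam (card S) = 1 \<and> (\<forall>y\<in>S. comb s c lam (card S) y = 0)"
proof -
  define d where "d = card S"
  obtain e where e: "bij_betw e {0..<d} S" using ex_bij_betw_nat_finite[OF assms(3)] d_def by auto
  obtain lam where lam: "\<exists>k\<le>d. lam k \<noteq> 0" "\<forall>i<d. (\<Sum>k\<le>d. u s (c + k) (e i) * lam k) = 0"
    using underdetermined_system[of d "\<lambda>i k. u s (c + k) (e i)"] by blast
  have z: "comb s c lam d y = 0" if "y \<in> S" for y
    using that lam(2) bij_betw_imp_surj_on[OF e] by (auto simp: mult.commute)
  have "lam d \<noteq> 0"
  proof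
    assume 0: "lam d = 0"
    then obtain d' where d': "d = Suc d'" using lam(1) by (cases d) auto
    then have "\<exists>k\<le>d'. lam k \<noteq> 0" using lam(1) 0 by (auto simp: le_Suc_eq)
    note zeros = comb_zeros[OF assms(1,2) this]
    have "S \<subseteq> {x\<in>J s. comb s c lam d' x = 0}" using z 0 assms(4) by (auto simp: d')
    from card_mono[OF zeros(1) this] have "d \<le> d'" using zeros(2) unfolding d_def by linarith
    then show False using d' by simp
  qed
  moreover have "comb s c (\<lambda>k. lam k / lam d) d y = comb s c lam d y / lam d" for y
    by (simp add: sum_divide_distrib)
  ultimately show ?thesis unfolding d_def[symmetric] using z
    by (intro exI[of _ "\<lambda>k. lam k / lam d"]) simp
qed

text \<open>With one density left all functions are powers, and the combination is
  \<open>x ^ c\<close> times a polynomial of degree \<open>d\<close> with root set \<open>S\<close>.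
  Here \<open>c\<close> is 0 or 1, so \<open>x ^ c\<close> contributes 1 or the side of the
  interval.\<close>

lemma oriented_chebyshev_last:
  assumes "Suc s = p"
  shows "oriented_chebyshev s"
  unfolding oriented_chebyshev_def
proof (intro allI impI ballI)
  fix c d lam S x
  assume c: "c \<le> p - s" and S: "finite S" "card S = d" "S \<subseteq> J s" and pos: "lam d > 0"
    and zero: "\<forall>y\<in>S. comb s c lam d y = 0" and x: "x \<in> J s - S"
  have sp: "s < p" using assms by simp
  have P: "p - s = Suc 0" using assms by simp
  define r where "r = (\<Sum>k\<le>d. monom (lam k) k)"
  have r: "degree r \<le> d" "coeff r d = lam d"
    by (auto simp: r_def coeff_sum intro!: degree_sum_le order.trans[OF degree_monom_le])
  have F: "comb s c lam d y = y ^ c * poly r y" for y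
    using u_multiple[of s] by (simp add: P r_def poly_sum poly_monom sum_distrib_left power_add mult_ac)
  have "poly r y = 0" if "y \<in> S" for y using zero that S F[of y] by auto
  then have "poly r x / (\<Prod>y\<in>S. x - y) = (\<Sum>y\<in>insert x S. poly r y / (\<Prod>z\<in>insert x S - {y}. y - z))"
    using x S by simp
  also have "\<dots> = lam d" unfolding r(2)[symmetric] by (rule coeff_eq_sum_divided) (use S x r in auto)
  finally have "(\<Prod>y\<in>S. x - y) * poly r x = (\<Prod>y\<in>S. x - y) ^ 2 * lam d"
    using x S by (auto simp: field_simps power2_eq_square)
  moreover have "(\<Prod>y\<in>S. x - y) \<noteq> 0" using x S by auto
  ultimately have r_pos: "(\<Prod>y\<in>S. x - y) * poly r x > 0" using pos by simp
  have "R s c d * x ^ c > 0"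
    using eta_pos[OF sp, of x] x c by (cases "c = 0") (auto simp: R_def P sign_pattern.simps(2) nonmultiples_def Let_def le_Suc_eq)
  then show "R s c d * (\<Prod>y\<in>S. x - y) * comb s c lam d x > 0"
    using mult_pos_pos[OF _ r_pos, of "R s c d * x ^ c"] unfolding F by (simp only: mult_ac)
qed

text \<open>After removal of \<open>x ^ \<delta>\<close> the combination is \<open>Fh\<close>, a
  polynomial plus the Cauchy transform of \<open>G\<close>, and \<open>G\<close> has at most
  \<open>B - 1\<close> zeros by the next level. Let \<open>q\<close> have the sign changes of
  \<open>G\<close> as roots. The multiplier \<open>[:-x, 1:] * q\<close> forces \<open>G\<close> to
  have all \<open>B - 1\<close> sign changes; the multiplier \<open>q\<close> then gives the sign of
  \<open>Fh x\<close>.\<close>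

lemma oriented_chebyshev_step:
  assumes s: "Suc s < p" and cheb: "oriented_chebyshev (Suc s)"
  shows "oriented_chebyshev s"
  unfolding oriented_chebyshev_def
proof (intro allI impI ballI)
  fix c d lam S x
  assume c: "c \<le> p - s" and S: "finite S" "card S = d" "S \<subseteq> J s" and pos: "lam d > 0"
    and zero: "\<forall>y\<in>S. comb s c lam d y = 0" and x: "x \<in> J s - S"
  note [measurable_cong] = sets_M[OF s]
  define P where "P = p - s"
  have P: "P \<ge> 1" "P = Suc (p - Suc s)" using s by (auto simp: P_def)
  define \<delta> :: nat where "\<delta> = (if c = 0 then 0 else 1)"
  define c' where "c' = (if c = 0 then p - s - 1 else c - 1)"
  have c': "c' \<le> p - Suc s" using c by (auto simp: c'_def)
  define B where "B = nonmultiples P (c + Suc d) - nonmultiples P c"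
  define A where "A = Suc d - B"
  have AB: "A + B = Suc d" using nonmultiples_range(2)[OF P(1), of c "Suc d"] by (simp add: A_def B_def)
  have B_pos: "B \<ge> 1" if "\<not> P dvd c + d"
    using nonmultiples_Suc[OF P(1), of "c + d"] nonmultiples_range(1)[OF P(1), of c d] that by (simp add: B_def)
  have A_pos: "A \<ge> 1" if "P dvd c + d"
    using nonmultiples_Suc[OF P(1), of "c + d"] nonmultiples_range(2)[OF P(1), of c d] that by (simp add: B_def A_def)
  obtain r \<mu> where r: "\<And>i. i \<ge> A \<Longrightarrow> coeff r i = 0"
    and top: "if P dvd c + d then coeff r (A - 1) = lam d else \<mu> (B - 1) = lam d"
    and F: "\<And>y. y \<in> I s \<Longrightarrow> (\<Sum>k<Suc d. lam k * u s (c + k) y) = y ^ \<delta> *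
       (poly r y + (\<integral>t. (\<Sum>b<B. \<mu> b * u (Suc s) (c' + b) t) / (y - t) \<partial>M (Suc s)))"
    using combination_decomposition[OF s c, of "Suc d" lam]
    unfolding A_def B_def \<delta>_def c'_def P_def by blast
  define G where "G t = (\<Sum>b<B. \<mu> b * u (Suc s) (c' + b) t)" for t
  define Fh where "Fh y = poly r y + (\<integral>t. G t / (y - t) \<partial>M (Suc s))" for y
  have F: "comb s c lam d y = y ^ \<delta> * Fh y" if "y \<in> I s" for y
    using F[OF that] by (simp only: lessThan_Suc_atMost Fh_def G_def)
  have G [measurable]: "G \<in> borel_measurable borel" and Gc: "continuous_on (I (Suc s)) G"
    unfolding G_def[abs_def] using s by (auto intro!: continuous_intros continuous_u)
  have SI: "S \<subseteq> I s" and xI: "x \<in> I s" "x \<notin> S" using S x by auto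
  have Fh0: "poly r y + (\<integral>t. G t / (y - t) \<partial>M (Suc s)) = 0" if "y \<in> S" for y
    using that zero F[of y] S(3) unfolding Fh_def by auto
  define W where "W t = (\<Prod>y\<in>S. t - y)" for t
  have W_meas [measurable]: "W \<in> borel_measurable borel"
    unfolding W_def[abs_def] by (intro borel_measurable_prod) simp
  have Wc: "continuous_on X W" for X unfolding W_def[abs_def] by (intro continuous_intros)
  have W_sign: "(- \<eta> s) ^ d * W t > 0" if "t \<in> I (Suc s)" for t
  proof -
    have "(- \<eta> s) ^ d * W t = (\<Prod>y\<in>S. - \<eta> s * (t - y))" unfolding W_def prod.distrib using S by simp
    also have "\<dots> > 0"
    proof (rule prod_pos)
      fix y assume "y \<in> S"
      then have "\<eta> s * (y - t) > 0" using eta_sep[OF s _ that] SI by auto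
      then show "- \<eta> s * (t - y) > 0" by (simp add: algebra_simps)
    qed
    finally show ?thesis .
  qed
  then have W0: "W t \<noteq> 0" if "t \<in> I (Suc s)" for t using that by fastforce
  have Wx: "W x \<noteq> 0" using S xI by (auto simp: W_def)
  \<comment> \<open>Since \<open>A + B = d + 1\<close>, a multiplier of degree below
    \<open>B\<close> cannot bring \<open>r\<close> up to degree \<open>d\<close>.\<close>
  have coeff0: "coeff (r * g) d = 0" "degree g \<le> d" if "degree g + 1 \<le> B" for g
    using coeff_mult_eq_0[of A r g d] r AB that by auto
  have ident: "Fh x * poly g x / W x = coeff (r * g) d + (\<integral>t. poly g t * G t / (W t * (x - t)) \<partial>M (Suc s))"
    if "degree g \<le> d" "degree g \<le> B" for g
  proof -
    have "degree (r * g) \<le> d"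
      using coeff_mult_eq_0[of A r g] r AB that by (intro degree_le) auto
    from interpolation_identity[OF s S(1,2) SI xI G Gc that(1) this Fh0]
    show ?thesis unfolding W_def Fh_def .
  qed
  have main: "\<exists>\<epsilon>\<in>{1,-1}. \<epsilon> * Fh x * W x > 0 \<and> \<epsilon> = (if P dvd c + d then \<eta> s ^ B
      else \<eta> s ^ B * ((- \<eta> s) ^ d * R (Suc s) c' (B - 1)))"
  proof (cases "B = 0")
    case True
    then have "P dvd c + d" using B_pos by auto
    have "Fh x / W x = lam d" using ident[of 1] top True AB \<open>P dvd c + d\<close> by (simp add: G_def)
    then have "Fh x * W x = lam d * (W x)\<^sup>2" using Wx by (simp add: field_simps power2_eq_square)
    then show ?thesis using True \<open>P dvd c + d\<close> pos Wx by simp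
  next
    case False
    \<comment> \<open>Otherwise \<open>Fh\<close> would be the polynomial \<open>r\<close> of exact
      degree \<open>A - 1 = d - B\<close>, below the number \<open>d\<close> of its zeros. The
      multiplier \<open>[:-x, 1:] ^ B\<close> exposes this: the left side of \<open>ident\<close>
      vanishes while the coefficient is \<open>lam d\<close>.\<close>
    have "\<exists>b\<le>B - 1. \<mu> b \<noteq> 0"
    proof (rule ccontr)
      assume "\<not> ?thesis"
      then have \<mu>0: "\<mu> b = 0" if "b < B" for b using that by auto
      then have dvd: "P dvd c + d" and G0: "G t = 0" for t using top pos False by (auto simp: G_def split: if_splits)
      have "degree r = A - 1" using r dvd top pos A_pos
        by (intro antisym degree_le le_degree) auto
      moreover have deg: "degree ([:-x, 1:] ^ B) = B" by (simp add: degree_power_eq)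
      moreover have "A - 1 + B = d" using A_pos[OF dvd] AB by simp
      ultimately have "coeff (r * [:-x, 1:] ^ B) d = lam d"
        using coeff_mult_degree_sum[of r "[:-x, 1:] ^ B"] dvd top lead_coeff_power[of "[:-x, 1:]" B] by simp
      then show False using ident[of "[:-x, 1:] ^ B"] deg A_pos[OF dvd] AB G0 pos False by (simp add: power_0_left)
    qed
    note zeros = comb_zeros[OF cheb c' this]
    have G_comb: "G t = comb (Suc s) c' \<mu> (B - 1) t" for t
    proof -
      have "{..<B} = {..B - 1}" using False by auto
      then show ?thesis by (simp only: G_def)
    qed
    define Z where "Z = {t\<in>J (Suc s). G t = 0}"
    have Z: "finite Z" "card Z \<le> B - 1" using zeros unfolding Z_def G_comb by auto
    obtain S' \<epsilon> where S': "S' \<subseteq> Z" and \<epsilon>: "\<epsilon> \<in> {1,-1}"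
      and sign': "\<forall>t\<in>J (Suc s). G t \<noteq> 0 \<longrightarrow> \<epsilon> * (\<Prod>y\<in>S'. t - y) * G t > 0"
      using sign_changes[OF interval_J[OF s] continuous_on_subset[OF Gc Diff_subset] Z(1)[unfolded Z_def], folded Z_def]
      by (elim exE conjE)
    have sign: "\<epsilon> * (\<Prod>y\<in>S'. t - y) * G t > 0" if "t \<in> J (Suc s) - Z" for t
      using sign' that by (auto simp: Z_def)
    have finS': "finite S'" using S' Z finite_subset by blast
    have cardS': "card S' \<le> B - 1" using card_mono[OF Z(1) S'] Z(2) by simp
    define q where "q = (\<Prod>y\<in>S'. [:-y, 1:])"
    note q = prod_linear_poly[OF finS', folded q_def]
    have qm [measurable]: "poly q \<in> borel_measurable borel"
      by (intro borel_measurable_continuous_onI continuous_intros)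
    \<comment> \<open>The sign of \<open>q * G / W\<close> on the next interval:
      \<open>\<epsilon>\<close> comes from \<open>q * G\<close>, and each of the \<open>d\<close>
      factors of \<open>W\<close> contributes \<open>- \<eta> s\<close>.\<close>
    define \<kappa> where "\<kappa> = \<epsilon> * (- \<eta> s) ^ d"
    have int1: "\<kappa> * (\<integral>t. poly q t * G t / W t \<partial>M (Suc s)) > 0"
    proof -
      have "(\<integral>t. \<kappa> * (poly q t * G t / W t) \<partial>M (Suc s)) > 0"
      proof (rule integral_M_pos[OF s _ _ Z(1)])
        show "continuous_on (I (Suc s)) (\<lambda>t. \<kappa> * (poly q t * G t / W t))"
          by (intro continuous_intros Gc Wc) (use W0 in auto)
        fix t assume t: "t \<in> J (Suc s) - Z"
        have "(\<epsilon> * poly q t * G t) * ((- \<eta> s) ^ d * W t) / (W t)\<^sup>2 > 0"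
          unfolding q(3) by (rule divide_pos_pos[OF mult_pos_pos[OF sign[OF t] W_sign]])
            (use W0[of t] t in auto)
        then show "\<kappa> * (poly q t * G t / W t) > 0"
          using W0[of t] t by (simp add: \<kappa>_def power2_eq_square mult_ac)
      qed measurable
      then show ?thesis by (simp del: times_divide_eq_right)
    qed
    have int2: "\<kappa> * \<eta> s * (\<integral>t. poly q t * G t / (W t * (x - t)) \<partial>M (Suc s)) > 0"
    proof -
      have "(\<integral>t. \<kappa> * \<eta> s * (poly q t * G t / (W t * (x - t))) \<partial>M (Suc s)) > 0"
      proof (rule integral_M_pos[OF s _ _ Z(1)])
        show "continuous_on (I (Suc s)) (\<lambda>t. \<kappa> * \<eta> s * (poly q t * G t / (W t * (x - t))))"
          by (intro continuous_intros Gc Wc) (use W0 sep[OF s xI(1)] in auto)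
        fix t assume t: "t \<in> J (Suc s) - Z"
        have "(\<epsilon> * poly q t * G t) * ((- \<eta> s) ^ d * W t) * (\<eta> s * (x - t)) / (W t * (x - t))\<^sup>2 > 0"
          unfolding q(3) by (rule divide_pos_pos[OF mult_pos_pos[OF mult_pos_pos[OF sign[OF t] W_sign] eta_sep[OF s xI(1)]]])
            (use W0[of t] t sep[OF s xI(1), of t] in auto)
        then show "\<kappa> * \<eta> s * (poly q t * G t / (W t * (x - t))) > 0"
          using W0[of t] sep[OF s xI(1), of t] t by (simp add: \<kappa>_def power2_eq_square mult_ac)
      qed measurable
      then show ?thesis by (simp del: times_divide_eq_right)
    qed
    \<comment> \<open>The factor \<open>[:-x, 1:]\<close> kills the left side of
      \<open>ident\<close> and cancels the kernel \<open>x - t\<close> up to sign.\<close>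
    have ident1: "coeff (r * ([:-x, 1:] * q)) d = (\<integral>t. poly q t * G t / W t \<partial>M (Suc s))"
      if "card S' + 1 \<le> d"
    proof -
      have "degree ([:-x, 1:] * q) = card S' + 1" using q by (subst degree_mult_eq) auto
      moreover have "card S' + 1 \<le> B" using cardS' False by linarith
      ultimately have "Fh x * poly ([:-x, 1:] * q) x / W x = coeff (r * ([:-x, 1:] * q)) d +
          (\<integral>t. poly ([:-x, 1:] * q) t * G t / (W t * (x - t)) \<partial>M (Suc s))"
        using that by (intro ident) simp_all
      moreover have "poly ([:-x, 1:] * q) x = 0" by simp
      ultimately have "coeff (r * ([:-x, 1:] * q)) d =
          - (\<integral>t. poly ([:-x, 1:] * q) t * G t / (W t * (x - t)) \<partial>M (Suc s))" by simp
      also have "\<dots> = (\<integral>t. - (poly ([:-x, 1:] * q) t * G t / (W t * (x - t))) \<partial>M (Suc s))"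
        by simp
      also have "\<dots> = (\<integral>t. poly q t * G t / W t \<partial>M (Suc s))"
      proof (rule integral_cong_AE)
        show "AE t in M (Suc s). - (poly ([:-x, 1:] * q) t * G t / (W t * (x - t))) = poly q t * G t / W t"
          using AE_M[OF s]
        proof eventually_elim
          case (elim t)
          have "x - t \<noteq> 0" using sep[OF s xI(1) elim] by simp
          moreover have "- (poly ([:-x, 1:] * q) t * G t / (W t * (x - t))) =
            (x - t) * (poly q t * G t) / ((x - t) * W t)"
            by (simp add: algebra_simps minus_divide_left)
          ultimately show ?case by simp
        qed
      qed (measurable, simp_all)
      finally show ?thesis .
    qed
    \<comment> \<open>With fewer sign changes the multiplier has degree below \<open>B\<close>, so
      the coefficient is zero although the integral is not.\<close>
    have card: "card S' = B - 1"
    proof (rule ccontr)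
      assume "card S' \<noteq> B - 1"
      then have *: "card S' + 2 \<le> B" using cardS' by simp
      have "degree ([:-x, 1:] * q) = card S' + 1" using q by (subst degree_mult_eq) auto
      then have "coeff (r * ([:-x, 1:] * q)) d = 0" using * by (intro coeff0(1)) simp
      then show False using int1 ident1 * AB by simp
    qed
    have "Fh x * poly q x / W x = (\<integral>t. poly q t * G t / (W t * (x - t)) \<partial>M (Suc s))"
      using ident[of q] coeff0[of q] q(1) card False by simp
    then have pos1: "\<kappa> * \<eta> s * (Fh x * poly q x / W x) > 0" using int2 by simp
    \<comment> \<open>The roots of \<open>q\<close> lie in the next interval, so \<open>x\<close> is
      on the same side of all \<open>B - 1\<close> of them.\<close>
    have pos2: "\<eta> s ^ (B - 1) * poly q x > 0"
    proof -
      have "\<eta> s ^ (B - 1) * poly q x = (\<Prod>y\<in>S'. \<eta> s * (x - y))" unfolding q(3) prod.distrib card[symmetric] by simp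
      also have "\<dots> > 0" by (rule prod_pos) (use eta_sep[OF s xI(1)] S' in \<open>auto simp: Z_def\<close>)
      finally show ?thesis .
    qed
    have etaB: "\<eta> s * \<eta> s ^ (B - 1) = \<eta> s ^ B" using False by (metis Suc_diff_1 neq0_conv power_Suc)
    have "poly q x \<noteq> 0" using pos2 by auto
    have "(\<kappa> * \<eta> s * (Fh x * poly q x / W x)) * (\<eta> s ^ (B - 1) * poly q x) * (W x / poly q x)\<^sup>2 > 0"
      by (intro mult_pos_pos pos1 pos2) (use Wx \<open>poly q x \<noteq> 0\<close> in auto)
    also have "(\<kappa> * \<eta> s * (Fh x * poly q x / W x)) * (\<eta> s ^ (B - 1) * poly q x) * (W x / poly q x)\<^sup>2 =
        \<kappa> * (\<eta> s * \<eta> s ^ (B - 1)) * Fh x * W x"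
    proof -
      have "k * e * (f * v / w) * (g * v) * (w / v)\<^sup>2 = k * (e * g) * f * w" if "v \<noteq> 0" "w \<noteq> 0"
        for k e f g v w :: real
        using that by (simp add: power2_eq_square)
      from this[OF \<open>poly q x \<noteq> 0\<close> Wx] show ?thesis .
    qed
    finally have sgn: "\<eta> s ^ B * \<kappa> * Fh x * W x > 0" unfolding etaB by (simp add: mult_ac)
    have pm: "y ^ n \<in> {1, -1}" if "y \<in> {1, -1}" for y :: real and n
      using that by (cases "even n") auto
    have \<kappa>_pm: "\<kappa> \<in> {1,-1}"
      using \<epsilon> pm[of "- \<eta> s" d] eta_cases[of s] unfolding \<kappa>_def by auto
    show ?thesis
    proof (cases "P dvd c + d")
      case True
      \<comment> \<open>The last function is a pure power, so \<open>lam d\<close> is the leading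
        coefficient of \<open>r\<close>. The multiplier of degree exactly \<open>B\<close> makes it
        visible in \<open>ident1\<close>, which fixes \<open>\<kappa>\<close>.\<close>
      have "degree r = A - 1" using r True top pos A_pos
        by (intro antisym degree_le le_degree) auto
      moreover have degq: "degree ([:-x, 1:] * q) = B" using q card False by (subst degree_mult_eq) auto
      moreover have "A - 1 + B = d" using A_pos[OF True] AB by simp
      moreover have "lead_coeff ([:-x, 1:] * q) = 1" using q(2) by (simp only: lead_coeff_mult) simp
      ultimately have "coeff (r * ([:-x, 1:] * q)) d = lam d"
        using coeff_mult_degree_sum[of r "[:-x, 1:] * q"] True top by simp
      then have "\<kappa> * lam d > 0" using ident1 int1 card AB A_pos[OF True] False by simp
      then have "\<kappa> = 1" using pos \<kappa>_pm by auto
      then show ?thesis using sgn True pm[of "\<eta> s" B] eta_cases[of s] by auto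
    next
      case dvd: False
      \<comment> \<open>Now \<open>lam d\<close> is the top coefficient of \<open>G\<close>.
        Comparing the two sign statements for \<open>G\<close> at a single point off its zeros
        identifies \<open>\<epsilon>\<close> with the orientation of the next level.\<close>
      have "infinite (J (Suc s) - Z)" using endpoints[OF s] Z(1) by simp
      then have "J (Suc s) - Z \<noteq> {}" by (rule infinite_imp_nonempty)
      then obtain t where t: "t \<in> J (Suc s)" "t \<notin> Z" by blast
      have "R (Suc s) c' (B - 1) * (\<Prod>y\<in>S'. t - y) * comb (Suc s) c' \<mu> (B - 1) t > 0"
      proof (rule oriented_chebyshevD[OF cheb c' finS' card])
        show "comb (Suc s) c' \<mu> (B - 1) y = 0" if "y \<in> S'" for y
          unfolding G_comb[symmetric] using that S' by (auto simp: Z_def)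
        show "\<mu> (B - 1) > 0" using top dvd pos by simp
      qed (use S' t in \<open>auto simp: Z_def\<close>)
      moreover have "\<epsilon> * (\<Prod>y\<in>S'. t - y) * comb (Suc s) c' \<mu> (B - 1) t > 0"
        using sign[of t] t unfolding G_comb by simp
      moreover have "e = f" if "f * v * w > 0" "e * v * w > 0" "e \<in> {1,-1}" "f = 1 \<or> f = -1" for e f v w :: real
        using that by auto
      ultimately have "\<epsilon> = R (Suc s) c' (B - 1)" using \<epsilon> R_cases by blast
      then have *: "\<eta> s ^ B * \<kappa> = \<eta> s ^ B * ((- \<eta> s) ^ d * R (Suc s) c' (B - 1))"
        by (simp only: \<kappa>_def mult_ac)
      have "\<eta> s ^ B * \<kappa> \<in> {1,-1}" using \<kappa>_pm pm[of "\<eta> s" B] eta_cases[of s] by auto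
      then show ?thesis using sgn dvd by (intro bexI[of _ "\<eta> s ^ B * \<kappa>"]) (simp_all only: * if_False simp_thms)
    qed
  qed
  define P' where "P' = p - Suc s"
  have R_s: "R s c d = sign_pattern P (\<eta> s) c d" by (simp add: R_def P_def)
  have R_Suc: "R (Suc s) c' (B - 1) = sign_pattern P' (- \<eta> s) c' (B - 1)" by (simp add: R_def P'_def)
  have P_Suc: "P = Suc P'" using P(2) by (simp add: P'_def)
  have B_eq: "B = nonmultiples (Suc P') (Suc (c + d)) - nonmultiples (Suc P') c"
    by (simp add: B_def P_Suc)
  have c'_eq: "c' = (if c = 0 then P' else c - 1)" by (simp add: c'_def P'_def)
  \<comment> \<open>The recursion of \<open>sign_pattern\<close> is read off from these
    contributions: \<open>\<eta> s ^ B\<close> from \<open>q\<close> at \<open>x\<close> and one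
    kernel, \<open>(- \<eta> s) ^ d\<close> from \<open>W\<close>, the orientation of
    \<open>G\<close>, and \<open>\<eta> s ^ \<delta>\<close> from the factor pulled out.\<close>
  have R_eq: "R s c d = (if P dvd c + d then \<eta> s ^ B
      else \<eta> s ^ B * ((- \<eta> s) ^ d * R (Suc s) c' (B - 1))) * \<eta> s ^ \<delta>"
    unfolding R_s R_Suc P_Suc sign_pattern.simps(2) Let_def B_eq[symmetric] c'_eq[symmetric] \<delta>_def
    by simp
  have "\<eta> s ^ \<delta> * x ^ \<delta> > 0" using eta_pos[of s x] s x by (simp add: \<delta>_def)
  moreover have "R s c d * (\<Prod>y\<in>S. x - y) * comb s c lam d x =
    ((if P dvd c + d then \<eta> s ^ B else \<eta> s ^ B * ((- \<eta> s) ^ d * R (Suc s) c' (B - 1))) * Fh x * W x) * (\<eta> s ^ \<delta> * x ^ \<delta>)"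
    unfolding R_eq F[OF xI(1)] W_def by (simp only: mult_ac)
  moreover obtain \<epsilon> where "\<epsilon> * Fh x * W x > 0" "\<epsilon> = (if P dvd c + d then \<eta> s ^ B
      else \<eta> s ^ B * ((- \<eta> s) ^ d * R (Suc s) c' (B - 1)))"
    using main by blast
  ultimately show "R s c d * (\<Prod>y\<in>S. x - y) * comb s c lam d x > 0"
    by (simp only: mult_pos_pos)
qed

lemma oriented_chebyshev:
  assumes "s < p"
  shows "oriented_chebyshev s"
proof -
  have "s \<le> p - 1" using assms by simp
  then show ?thesis
  proof (induction s rule: inc_induct)
    case base
    show ?case by (rule oriented_chebyshev_last) (use assms in simp)
  next
    case (step n)
    then show ?case by (auto intro: oriented_chebyshev_step[of n])
  qed
qed

end

subsection \<open>Orthogonal polynomials on the line\<close>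

context line_nikishin begin

text \<open>Pair \<open>q\<close> with the combination that vanishes exactly at the sign changes of
  \<open>q\<close>: the product keeps one sign, so the integral is nonzero with known sign.\<close>

lemma orthogonal_poly_pairing:
  assumes p: "0 < p" and c: "c \<le> p" and q: "q \<noteq> 0"
  shows "\<exists>S \<epsilon> lam. finite S \<and> card S \<le> degree q \<and> (\<forall>y\<in>S. poly q y = 0) \<and> \<epsilon> \<in> {1,-1} \<and>
    (\<forall>x\<in>J 0. poly q x \<noteq> 0 \<longrightarrow> \<epsilon> * (\<Prod>y\<in>S. x - y) * poly q x > 0) \<and> lam (card S) = 1 \<and>
    \<epsilon> * R 0 c (card S) * (\<Sum>k\<le>card S. lam k * (\<integral>x. poly q x * u 0 (c + k) x \<partial>M 0)) > 0"
proof -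
  have cp: "c \<le> p - 0" using c by simp
  note cheb = oriented_chebyshev[OF p]
  define Z where "Z = {x\<in>J 0. poly q x = 0}"
  have Z: "finite Z" using finite_subset[OF _ poly_roots_finite[OF q]] by (auto simp: Z_def)
  have "card Z \<le> card {x. poly q x = 0}"
    by (rule card_mono[OF poly_roots_finite[OF q]]) (auto simp: Z_def)
  also have "\<dots> \<le> degree q" by (rule card_poly_roots_bound[OF q])
  finally have card_Z: "card Z \<le> degree q" .
  have cont: "continuous_on X (poly q)" for X by (intro continuous_intros)
  have meas [measurable]: "poly q \<in> borel_measurable borel"
    by (intro borel_measurable_continuous_onI cont)
  obtain S \<epsilon> where S: "S \<subseteq> Z" and \<epsilon>: "\<epsilon> \<in> {1,-1}"
    and sign: "\<forall>x\<in>J 0. poly q x \<noteq> 0 \<longrightarrow> \<epsilon> * (\<Prod>y\<in>S. x - y) * poly q x > 0"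
    using sign_changes[OF interval_J[OF p] cont Z[unfolded Z_def], folded Z_def]
    by (elim exE conjE)
  have finS: "finite S" using finite_subset[OF S Z] .
  have SJ: "S \<subseteq> J 0" using S by (auto simp: Z_def)
  obtain lam where lam: "lam (card S) = 1" "\<And>y. y \<in> S \<Longrightarrow> comb 0 c lam (card S) y = 0"
    using comb_interpolation[OF cheb cp finS SJ] by blast
  have int: "integrable (M 0) (\<lambda>x. poly q x * u 0 (c + k) x)" for k
    using p by (intro integrable_M) (auto intro!: continuous_intros continuous_u)
  have "(\<integral>x. \<epsilon> * R 0 c (card S) * (poly q x * comb 0 c lam (card S) x) \<partial>M 0) > 0"
  proof (rule integral_M_pos[OF p _ _ Z])
    show "continuous_on (I 0) (\<lambda>x. \<epsilon> * R 0 c (card S) * (poly q x * comb 0 c lam (card S) x))"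
      by (intro continuous_intros continuous_u[OF p])
    fix x assume x: "x \<in> J 0 - Z"
    have R_pos: "R 0 c (card S) * (\<Prod>y\<in>S. x - y) * comb 0 c lam (card S) x > 0"
      by (rule oriented_chebyshevD[OF cheb cp finS refl SJ]) (use lam x S in auto)
    have q_pos: "\<epsilon> * (\<Prod>y\<in>S. x - y) * poly q x > 0" using sign x by (auto simp: Z_def)
    have "(\<epsilon> * (\<Prod>y\<in>S. x - y) * poly q x) * (R 0 c (card S) * (\<Prod>y\<in>S. x - y) * comb 0 c lam (card S) x) =
      (\<epsilon> * R 0 c (card S) * (poly q x * comb 0 c lam (card S) x)) * (\<Prod>y\<in>S. x - y)\<^sup>2"
      by (simp only: power2_eq_square mult_ac)
    then have "0 < (\<epsilon> * R 0 c (card S) * (poly q x * comb 0 c lam (card S) x)) * (\<Prod>y\<in>S. x - y)\<^sup>2"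
      using mult_pos_pos[OF q_pos R_pos] by (simp only:)
    then show "\<epsilon> * R 0 c (card S) * (poly q x * comb 0 c lam (card S) x) > 0"
      by (auto simp: zero_less_mult_iff[of _ "(\<Prod>y\<in>S. x - y)\<^sup>2"] not_less)
  qed (use p in measurable)
  also have "(\<integral>x. \<epsilon> * R 0 c (card S) * (poly q x * comb 0 c lam (card S) x) \<partial>M 0) =
      \<epsilon> * R 0 c (card S) * (\<integral>x. poly q x * comb 0 c lam (card S) x \<partial>M 0)"
    by (rule integral_mult_right_zero)
  also have "(\<lambda>x. poly q x * comb 0 c lam (card S) x) = (\<lambda>x. \<Sum>k\<le>card S. lam k * (poly q x * u 0 (c + k) x))"
    by (simp add: sum_distrib_left mult_ac)
  also have "(\<integral>x. (\<Sum>k\<le>card S. lam k * (poly q x * u 0 (c + k) x)) \<partial>M 0) =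
      (\<Sum>k\<le>card S. lam k * (\<integral>x. poly q x * u 0 (c + k) x \<partial>M 0))"
    by (subst Bochner_Integration.integral_sum) (auto intro: int)
  finally have pos: "\<epsilon> * R 0 c (card S) *
      (\<Sum>k\<le>card S. lam k * (\<integral>x. poly q x * u 0 (c + k) x \<partial>M 0)) > 0" .
  moreover have "card S \<le> degree q" using card_mono[OF Z S] card_Z by simp
  moreover have "\<forall>y\<in>S. poly q y = 0" using S by (auto simp: Z_def)
  ultimately show ?thesis using finS \<epsilon> sign lam(1) by blast
qed

text \<open>With fewer than \<open>D\<close> sign changes, the combination paired with
  \<open>q\<close> would involve only functions to which \<open>q\<close> is orthogonal.\<close>

lemma orthogonal_degree:
  assumes "0 < p" "c \<le> p" "q \<noteq> 0"
    and orth: "\<And>k. k < D \<Longrightarrow> (\<integral>x. poly q x * u 0 (c + k) x \<partial>M 0) = 0"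
  shows "degree q \<ge> D"
proof -
  obtain S \<epsilon> lam where "finite S" and card: "card S \<le> degree q"
    and "\<forall>y\<in>S. poly q y = 0" and "\<epsilon> \<in> {1,-1}"
    and "\<forall>x\<in>J 0. poly q x \<noteq> 0 \<longrightarrow> \<epsilon> * (\<Prod>y\<in>S. x - y) * poly q x > 0"
    and "lam (card S) = 1"
    and pos: "\<epsilon> * R 0 c (card S) * (\<Sum>k\<le>card S. lam k * (\<integral>x. poly q x * u 0 (c + k) x \<partial>M 0)) > 0"
    using orthogonal_poly_pairing[OF assms(1-3)] by (elim exE conjE)
  have "card S \<ge> D"
  proof (rule ccontr)
    assume "\<not> card S \<ge> D"
    then have "(\<Sum>k\<le>card S. lam k * (\<integral>x. poly q x * u 0 (c + k) x \<partial>M 0)) = 0"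
      by (intro sum.neutral) (auto simp: orth)
    then show False using pos by simp
  qed
  then show ?thesis using card by simp
qed

text \<open>Orthogonality forces \<open>D\<close> sign changes, so these are all the roots of
  \<open>q\<close>, and in the pairing only the last summand survives.\<close>

lemma orthogonal_sign:
  assumes "0 < p" "c \<le> p" and q: "degree q = D" "lead_coeff q = 1"
    and orth: "\<And>k. k < D \<Longrightarrow> (\<integral>x. poly q x * u 0 (c + k) x \<partial>M 0) = 0"
  shows "R 0 c D * (\<integral>x. poly q x * u 0 (c + D) x \<partial>M 0) > 0"
proof -
  have "q \<noteq> 0" using q by auto
  obtain S \<epsilon> lam where S: "finite S" and card: "card S \<le> degree q"
    and zero: "\<forall>y\<in>S. poly q y = 0" and \<epsilon>: "\<epsilon> \<in> {1,-1}"
    and sign: "\<forall>x\<in>J 0. poly q x \<noteq> 0 \<longrightarrow> \<epsilon> * (\<Prod>y\<in>S. x - y) * poly q x > 0"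
    and lam: "lam (card S) = 1"
    and pos: "\<epsilon> * R 0 c (card S) * (\<Sum>k\<le>card S. lam k * (\<integral>x. poly q x * u 0 (c + k) x \<partial>M 0)) > 0"
    using orthogonal_poly_pairing[OF assms(1,2) \<open>q \<noteq> 0\<close>] by (elim exE conjE)
  have "card S = D"
  proof (rule ccontr)
    assume "card S \<noteq> D"
    then have "(\<Sum>k\<le>card S. lam k * (\<integral>x. poly q x * u 0 (c + k) x \<partial>M 0)) = 0"
      using card q by (intro sum.neutral) (auto simp: orth)
    then show False using pos by simp
  qed
  have "(\<Sum>k\<le>D. lam k * (\<integral>x. poly q x * u 0 (c + k) x \<partial>M 0)) =
      (\<Sum>k\<in>{D}. lam k * (\<integral>x. poly q x * u 0 (c + k) x \<partial>M 0))"
    by (rule sum.mono_neutral_right) (auto simp: orth)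
  then have pos: "\<epsilon> * R 0 c D * (\<integral>x. poly q x * u 0 (c + D) x \<partial>M 0) > 0"
    using pos lam \<open>card S = D\<close> by simp
  have "infinite (J 0 - {x. poly q x = 0})"
    using endpoints[OF assms(1)] poly_roots_finite[OF \<open>q \<noteq> 0\<close>] by simp
  then have "J 0 - {x. poly q x = 0} \<noteq> {}" by (rule infinite_imp_nonempty)
  then obtain x where x: "x \<in> J 0" "poly q x \<noteq> 0" by blast
  then have "x \<notin> S" using zero by blast
  \<comment> \<open>Being monic of degree \<open>D\<close> with \<open>D\<close> known roots,
    \<open>q\<close> equals the product; its value at one point determines
    \<open>\<epsilon>\<close>.\<close>
  then have "poly q x / (\<Prod>y\<in>S. x - y) = (\<Sum>y\<in>insert x S. poly q y / (\<Prod>z\<in>insert x S - {y}. y - z))"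
    using S zero by simp
  also have "\<dots> = 1"
    using coeff_eq_sum_divided[of "insert x S" D q] S \<open>x \<notin> S\<close> \<open>card S = D\<close> q by simp
  finally have q_eq: "poly q x = (\<Prod>y\<in>S. x - y)" by (simp add: divide_eq_1_iff)
  have "\<epsilon> * (\<Prod>y\<in>S. x - y) * poly q x > 0" using sign x by blast
  then have "\<epsilon> * (poly q x)\<^sup>2 > 0" unfolding q_eq by (simp only: power2_eq_square mult.assoc)
  then have "\<epsilon> = 1" using \<epsilon> by (auto simp: zero_less_mult_iff)
  then show ?thesis using pos by simp
qed

end

subsection \<open>Reduction of the star to the line\<close>

lemma finite_power_fiber:
  assumes "n > 0"
  shows "finite {z::complex. z ^ n = a}"
proof -
  have "{z. z ^ n = a} \<subseteq> {z. poly (monom 1 n - [:a:]) z = 0}" by (auto simp: poly_monom)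
  moreover have "monom 1 n - [:a:] \<noteq> 0"
  proof
    assume "monom 1 n - [:a:] = 0"
    then have "monom 1 n = [:a:]" by simp
    then have "degree (monom (1::complex) n) = 0" by simp
    then show False using assms by (simp add: degree_monom_eq)
  qed
  ultimately show ?thesis using poly_roots_finite finite_subset by blast
qed

lemma closed_star_set: "closed (star_set p a b)"
proof -
  have "star_set p a b = (\<lambda>z. z ^ (p + 1)) -` (complex_of_real ` {a..b})"
    by (auto simp: star_set_def)
  moreover have "closed (complex_of_real ` {a..b})"
    by (intro compact_imp_closed compact_continuous_image continuous_intros compact_Icc)
  ultimately show ?thesis by (simp only:) (intro closed_vimage continuous_intros)
qed

lemma bounded_star_set: "bounded (star_set p a b)"
proof (rule boundedI)
  fix z assume "z \<in> star_set p a b"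
  then obtain x where x: "x \<in> {a..b}" "z ^ (p + 1) = complex_of_real x" by (auto simp: star_set_def)
  then have "norm z ^ (p + 1) = \<bar>x\<bar>" by (metis norm_of_real norm_power)
  also have "\<dots> \<le> max \<bar>a\<bar> \<bar>b\<bar> + 1" using x by auto
  finally have le: "norm z ^ (p + 1) \<le> max \<bar>a\<bar> \<bar>b\<bar> + 1" .
  show "norm z \<le> max \<bar>a\<bar> \<bar>b\<bar> + 1"
  proof (cases "norm z \<le> 1")
    case False
    then have "norm z \<le> norm z ^ (p + 1)" using power_increasing[of 1 "p + 1" "norm z"] by simp
    then show ?thesis using le by simp
  qed auto
qed

lemma compact_star_set: "compact (star_set p a b)"
  using closed_star_set bounded_star_set by (simp add: compact_eq_bounded_closed)

lemma star_setD:
  assumes "z \<in> star_set p a b"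
  shows "Re (z ^ (p + 1)) \<in> {a..b}" "complex_of_real (Re (z ^ (p + 1))) = z ^ (p + 1)"
proof -
  obtain x where "x \<in> {a..b}" "z ^ (p + 1) = complex_of_real x" using assms by (auto simp: star_set_def)
  then show "Re (z ^ (p + 1)) \<in> {a..b}" "complex_of_real (Re (z ^ (p + 1))) = z ^ (p + 1)"
    by (simp_all only: Re_complex_of_real)
qed

text \<open>This carries disjointness of the stars over to the intervals.\<close>

lemma star_set_surj:
  assumes "x \<in> {a..b}"
  shows "\<exists>z\<in>star_set p a b. z ^ (p + 1) = complex_of_real x"
proof -
  obtain z where "z ^ (p + 1) = complex_of_real x"
  proof (cases "x = 0")
    case False
    have "(of_real (root (p + 1) \<bar>x\<bar>) * cis (Arg (complex_of_real x) / real (p + 1))) ^ (p + 1) =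
        of_real \<bar>x\<bar> * cis (Arg (complex_of_real x))"
      by (simp only: power_mult_distrib Complex.DeMoivre of_real_power[symmetric])
        (simp add: real_root_pow_pos2 del: power_Suc)
    also have "\<dots> = complex_of_real x" using cis_Arg[of "complex_of_real x"] False
      by (auto simp: sgn_of_real sgn_real_def) 
    finally show ?thesis using that by blast
  qed (use that[of 0] in simp)
  then show ?thesis using assms by (intro bexI[of _ z]) (auto simp: star_set_def)
qed

locale star_nikishin =
  fixes p :: nat and \<alpha> \<beta> :: "nat \<Rightarrow> real" and \<sigma> :: "nat \<Rightarrow> complex measure"
  assumes p_pos: "p \<ge> 1"
    and even_int: "\<And>j. j < p \<Longrightarrow> even j \<Longrightarrow> 0 \<le> \<alpha> j \<and> \<alpha> j < \<beta> j"
    and odd_int: "\<And>j. j < p \<Longrightarrow> odd j \<Longrightarrow> \<alpha> j < \<beta> j \<and> \<beta> j \<le> 0"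
    and star_disjoint: "\<And>j. Suc j < p \<Longrightarrow>
           star_set p (\<alpha> j) (\<beta> j) \<inter> star_set p (\<alpha> (Suc j)) (\<beta> (Suc j)) = {}"
    and star_meas: "\<And>j. j < p \<Longrightarrow> star_measure p (star_set p (\<alpha> j) (\<beta> j)) (\<sigma> j)"
begin

abbreviation S :: "nat \<Rightarrow> complex set" where "S j \<equiv> star_set p (\<alpha> j) (\<beta> j)"
definition \<omega> :: complex where "\<omega> = cis (2 * pi / real (p + 1))"
text \<open>On a star the power is real, so taking the real part only makes the map real-valued on
  the whole plane.\<close>

abbreviation \<pi>\<^sub>r :: "complex \<Rightarrow> real" where "\<pi>\<^sub>r z \<equiv> Re (z ^ (p + 1))"
definition M :: "nat \<Rightarrow> real measure" where "M j = distr (\<sigma> j) borel \<pi>\<^sub>r"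
abbreviation f :: "nat \<Rightarrow> nat \<Rightarrow> complex \<Rightarrow> complex" where "f \<equiv> nikishin_density \<sigma>"

lemma
  assumes "j < p"
  shows sets_\<sigma>: "sets (\<sigma> j) = sets borel" and finite_\<sigma>: "finite_measure (\<sigma> j)"
    and null_\<sigma>: "emeasure (\<sigma> j) (- S j) = 0" and rot_\<sigma>: "distr (\<sigma> j) borel (\<lambda>z. \<omega> * z) = \<sigma> j"
    and inf_\<sigma>: "infinite (measure_support (\<sigma> j))"
  using star_meas[OF assms] by (auto simp: star_measure_def \<omega>_def)

lemma space_\<sigma>: "j < p \<Longrightarrow> space (\<sigma> j) = UNIV"
  using sets_eq_imp_space_eq[OF sets_\<sigma>] by simp

lemma AE_\<sigma>: assumes "j < p" shows "AE z in \<sigma> j. z \<in> S j"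
proof (rule AE_I[OF _ null_\<sigma>[OF assms]])
  show "- S j \<in> sets (\<sigma> j)" unfolding sets_\<sigma>[OF assms]
    by (intro borel_open open_Compl closed_star_set)
qed auto

lemma measurable_\<pi>: "j < p \<Longrightarrow> \<pi>\<^sub>r \<in> measurable (\<sigma> j) borel"
proof -
  assume "j < p"
  note [measurable_cong] = sets_\<sigma>[OF this]
  have "(\<lambda>z::complex. z ^ (p + 1)) \<in> borel_measurable borel" by measurable
  then show ?thesis by measurable
qed

lemma sigma_cofinite:
  assumes "j < p" "finite Z"
  shows "emeasure (\<sigma> j) (- Z) \<noteq> 0"
proof
  assume 0: "emeasure (\<sigma> j) (- Z) = 0"
  have "measure_support (\<sigma> j) \<subseteq> Z"
  proof (rule ccontr)
    assume "\<not> ?thesis"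
    then obtain z where z: "z \<in> measure_support (\<sigma> j)" "z \<in> - Z" by auto
    have "open (- Z)" using assms(2) by (intro open_Compl finite_imp_closed)
    then show False using z 0 by (auto simp: measure_support_def)
  qed
  then show False using inf_\<sigma>[OF assms(1)] assms(2) finite_subset by blast
qed

sublocale line: line_nikishin p \<alpha> \<beta> M
proof (rule line_nikishin.intro)
  fix j assume j: "j < p"
  note [measurable] = measurable_\<pi>[OF j]
  show "sets (M j) = sets borel" by (simp add: M_def)
  interpret finite_measure "\<sigma> j" using finite_\<sigma>[OF j] .
  show "finite_measure (M j)" unfolding M_def by (rule finite_measure_distr) (rule measurable_\<pi>[OF j])
  show "AE x in M j. x \<in> {\<alpha> j..\<beta> j}" unfolding M_def
  proof (subst AE_distr_iff)
    show "AE z in \<sigma> j. \<pi>\<^sub>r z \<in> {\<alpha> j..\<beta> j}" using AE_\<sigma>[OF j]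
      by eventually_elim (rule star_setD(1))
  qed measurable
  fix Z :: "real set" assume Z: "finite Z"
  \<comment> \<open>A finite set on the line has a finite preimage in the star, since every fibre of
    the power map is finite; infinite support of \<open>\<sigma> j\<close> therefore prevents
    \<open>M j\<close> from living on \<open>Z\<close>.\<close>
  define Y where "Y = {z \<in> S j. \<pi>\<^sub>r z \<in> Z}"
  have "Y \<subseteq> (\<Union>x\<in>Z. {z. z ^ (p + 1) = complex_of_real x})"
    using star_setD(2) by (force simp: Y_def)
  moreover have "finite (\<Union>x\<in>Z. {z. z ^ (p + 1) = complex_of_real x})"
    by (intro finite_UN_I Z finite_power_fiber) simp
  ultimately have Y: "finite Y" by (rule finite_subset)
  show "emeasure (M j) (- Z) \<noteq> 0"
  proof
    assume 0: "emeasure (M j) (- Z) = 0"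
    have Zm: "- Z \<in> sets borel" using Z by (intro borel_open open_Compl finite_imp_closed)
    have "emeasure (\<sigma> j) (\<pi>\<^sub>r -` (- Z) \<inter> space (\<sigma> j)) = 0"
      using 0 unfolding M_def by (subst (asm) emeasure_distr[OF measurable_\<pi>[OF j] Zm]) 
    then have "AE z in \<sigma> j. \<pi>\<^sub>r z \<in> Z"
      by (intro AE_I[of _ _ "\<pi>\<^sub>r -` (- Z) \<inter> space (\<sigma> j)"] measurable_sets[OF measurable_\<pi>[OF j] Zm]) auto
    then have "AE z in \<sigma> j. z \<in> Y" using AE_\<sigma>[OF j] by eventually_elim (simp add: Y_def)
    moreover have "- Y \<in> sets (\<sigma> j)" unfolding sets_\<sigma>[OF j]
      using Y by (intro borel_open open_Compl finite_imp_closed)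
    ultimately have "emeasure (\<sigma> j) (- Y) = 0"
      by (subst (asm) AE_iff_measurable[where N = "- Y"]) (auto simp: space_\<sigma>[OF j])
    then show False using sigma_cofinite[OF j Y] by simp
  qed
next
  fix j assume j: "Suc j < p"
  show "{\<alpha> j..\<beta> j} \<inter> {\<alpha> (Suc j)..\<beta> (Suc j)} = {}"
  proof (rule ccontr)
    assume "\<not> ?thesis"
    then obtain x where x: "x \<in> {\<alpha> j..\<beta> j}" "x \<in> {\<alpha> (Suc j)..\<beta> (Suc j)}" by blast
    obtain z where "z \<in> S j" "z ^ (p + 1) = complex_of_real x" using star_set_surj[OF x(1)] by blast
    then have "z \<in> S j \<inter> S (Suc j)" using x by (auto simp: star_set_def)
    then show False using star_disjoint[OF j] by simp
  qed
qed (use even_int odd_int in auto)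

section \<open>Rotational covariance of the densities\<close>

lemma omega_power: "\<omega> ^ (p + 1) = 1"
  by (simp add: \<omega>_def Complex.DeMoivre del: power_Suc)

lemma omega_mod: "\<omega> ^ m = \<omega> ^ (m mod (p + 1))"
proof -
  have "\<omega> ^ m = \<omega> ^ (m div (p + 1) * (p + 1) + m mod (p + 1))" by (simp only: div_mult_mod_eq)
  also have "\<dots> = (\<omega> ^ (p + 1)) ^ (m div (p + 1)) * \<omega> ^ (m mod (p + 1))"
    by (simp only: power_add power_mult mult.commute[of _ "p + 1"])
  finally show ?thesis by (simp only: omega_power power_one mult_1)
qed

lemma omega_inj:
  assumes "\<omega> ^ a = \<omega> ^ b" "a \<le> p" "b \<le> p"
  shows "a = b"
proof -
  have "inj_on (\<lambda>k. cis (2 * pi * real k / real (p + 1))) {..<p + 1}"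
    using Complex.bij_betw_roots_unity[of "p + 1"] by (simp add: bij_betw_def)
  moreover have "\<omega> ^ k = cis (2 * pi * real k / real (p + 1))" for k
    by (simp add: \<omega>_def Complex.DeMoivre mult_ac)
  ultimately show ?thesis using assms by (auto simp: inj_on_def)
qed

lemma integral_rotation:
  fixes h :: "complex \<Rightarrow> complex"
  assumes "j < p" "h \<in> borel_measurable borel"
  shows "(\<integral>z. h (\<omega> * z) \<partial>\<sigma> j) = (\<integral>z. h z \<partial>\<sigma> j)"
proof -
  note [measurable_cong] = sets_\<sigma>[OF assms(1)]
  have "(\<integral>z. h z \<partial>\<sigma> j) = (\<integral>z. h z \<partial>distr (\<sigma> j) borel (\<lambda>z. \<omega> * z))"
    by (simp only: rot_\<sigma>[OF assms(1)])
  also have "\<dots> = (\<integral>z. h (\<omega> * z) \<partial>\<sigma> j)"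
    by (rule integral_distr) (use assms(2) in measurable)
  finally show ?thesis by simp
qed

text \<open>By invariance of the measure the integral is an eigenvalue relation with itself: its
  products with \<open>\<omega> ^ a\<close> and \<open>\<omega> ^ b\<close> agree, and these powers
  differ.\<close>

lemma integral_zero_if_covariant:
  fixes h :: "complex \<Rightarrow> complex"
  assumes "j < p" "h \<in> borel_measurable borel" "\<And>z. h (\<omega> * z) * \<omega> ^ a = \<omega> ^ b * h z"
    "a \<le> p" "b \<le> p" "a \<noteq> b"
  shows "(\<integral>z. h z \<partial>\<sigma> j) = 0"
proof -
  have "(\<integral>z. h z \<partial>\<sigma> j) * \<omega> ^ a = (\<integral>z. h (\<omega> * z) * \<omega> ^ a \<partial>\<sigma> j)"
    by (simp only: integral_mult_left_zero integral_rotation[OF assms(1,2)])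
  also have "\<dots> = \<omega> ^ b * (\<integral>z. h z \<partial>\<sigma> j)" by (simp only: assms(3) integral_mult_right_zero)
  finally have "(\<integral>z. h z \<partial>\<sigma> j) * (\<omega> ^ a - \<omega> ^ b) = 0" by (simp add: algebra_simps)
  then show ?thesis using omega_inj[of a b] assms(4-6) by auto
qed

lemma measurable_f: "j < p \<Longrightarrow> f k j \<in> borel_measurable borel"
proof (induction "j - k" arbitrary: k)
  case 0
  then have "f k j = (\<lambda>_. 1)" by (auto simp: nikishin_density.simps)
  then show ?case by simp
next
  case (Suc n)
  then have k: "k < j" by simp
  then have [measurable]: "f (Suc k) j \<in> borel_measurable borel"
    using Suc by (intro Suc(1)) auto
  have kp: "Suc k < p" using k Suc by simp
  interpret finite_measure "\<sigma> (Suc k)" using finite_\<sigma> kp .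
  note [measurable_cong] = sets_\<sigma>[OF kp]
  have "(\<lambda>z. \<integral>t. 1 / (z - t) * f (Suc k) j t \<partial>\<sigma> (Suc k)) \<in> borel_measurable borel"
    by measurable
  also have "(\<lambda>z. \<integral>t. 1 / (z - t) * f (Suc k) j t \<partial>\<sigma> (Suc k)) = f k j"
    using k by (auto simp: nikishin_density.simps[of _ k])
  finally show ?case .
qed

text \<open>Each kernel \<open>1 / (z - t)\<close> is homogeneous of degree -1, so every level
  between \<open>k\<close> and \<open>j\<close> contributes one inverse factor
  \<open>\<omega>\<close>. The value 0 of a divergent integral respects these rules, hence the
  identity holds at every \<open>z\<close>.\<close>

lemma f_rotation: "j < p \<Longrightarrow> k \<le> j \<Longrightarrow> f k j (\<omega> * z) * \<omega> ^ (j - k) = f k j z"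
proof (induction "j - k" arbitrary: k z)
  case 0
  then have "k = j" by linarith
  then show ?case by (simp add: nikishin_density.simps)
next
  case (Suc n)
  then have k: "k < j" by linarith
  have kp: "Suc k < p" using k Suc.prems by simp
  note mf = measurable_f[OF \<open>j < p\<close>]
  have [measurable]: "f (Suc k) j \<in> borel_measurable borel" by (rule mf)
  have IH: "f (Suc k) j (\<omega> * t) * \<omega> ^ (j - Suc k) = f (Suc k) j t" for t
    by (rule Suc.hyps(1)) (use Suc k in linarith)+
  have e: "\<omega> ^ (j - k) = \<omega> * \<omega> ^ (j - Suc k)" using k by (metis Suc_diff_Suc power_Suc)
  have "f k j (\<omega> * z) = (\<integral>t. 1 / (\<omega> * z - t) * f (Suc k) j t \<partial>\<sigma> (Suc k))"
    using k by (simp add: nikishin_density.simps[of _ k])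
  also have "\<dots> = (\<integral>t. 1 / (\<omega> * z - \<omega> * t) * f (Suc k) j (\<omega> * t) \<partial>\<sigma> (Suc k))"
    by (rule integral_rotation[OF kp, symmetric]) measurable
  finally have "f k j (\<omega> * z) * \<omega> ^ (j - k) =
      (\<integral>t. 1 / (\<omega> * z - \<omega> * t) * f (Suc k) j (\<omega> * t) * \<omega> ^ (j - k) \<partial>\<sigma> (Suc k))"
    by (simp only: integral_mult_left_zero)
  also have "\<dots> = (\<integral>t. 1 / (z - t) * f (Suc k) j t \<partial>\<sigma> (Suc k))"
  proof (rule Bochner_Integration.integral_cong)
    fix t
    have "1 / (\<omega> * z - \<omega> * t) * f (Suc k) j (\<omega> * t) * \<omega> ^ (j - k) =
      \<omega> / (\<omega> * (z - t)) * (f (Suc k) j (\<omega> * t) * \<omega> ^ (j - Suc k))"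
      unfolding e by (simp add: right_diff_distrib)
    then show "1 / (\<omega> * z - \<omega> * t) * f (Suc k) j (\<omega> * t) * \<omega> ^ (j - k) = 1 / (z - t) * f (Suc k) j t"
      unfolding IH by (simp add: \<omega>_def)
  qed simp
  finally show ?case using k by (simp add: nikishin_density.simps[of _ k])
qed

lemma integrable_bounded:
  fixes h :: "complex \<Rightarrow> complex"
  assumes "j < p" "h \<in> borel_measurable borel" "\<And>z. z \<in> S j \<Longrightarrow> norm (h z) \<le> C"
  shows "integrable (\<sigma> j) h"
proof -
  interpret finite_measure "\<sigma> j" using finite_\<sigma>[OF assms(1)] .
  have "AE z in \<sigma> j. norm (h z) \<le> C" using AE_\<sigma>[OF assms(1)] assms(3) by auto
  moreover have "h \<in> borel_measurable (\<sigma> j)"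
    using assms(2) sets_\<sigma>[OF assms(1)] by (simp cong: measurable_cong_sets)
  ultimately show ?thesis by (rule integrable_const_bound)
qed

lemma f_bounded: "j < p \<Longrightarrow> k \<le> j \<Longrightarrow> \<exists>C. \<forall>z\<in>S k. norm (f k j z) \<le> C"
proof (induction "j - k" arbitrary: k)
  case 0
  then have "k = j" by linarith
  then show ?case by (auto simp: nikishin_density.simps)
next
  case (Suc n)
  then have k: "k < j" by linarith
  have kp: "Suc k < p" using k Suc.prems by simp
  have [measurable]: "f (Suc k) j \<in> borel_measurable borel" by (rule measurable_f[OF \<open>j < p\<close>])
  have "\<exists>C. \<forall>z\<in>S (Suc k). norm (f (Suc k) j z) \<le> C"
    by (rule Suc.hyps(1)) (use Suc k in linarith)+
  then obtain C where C: "\<And>t. t \<in> S (Suc k) \<Longrightarrow> norm (f (Suc k) j t) \<le> C" by blast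
  obtain d where d: "d > 0" "\<And>z t. z \<in> S k \<Longrightarrow> t \<in> S (Suc k) \<Longrightarrow> d \<le> dist z t"
    using separate_compact_closed[OF compact_star_set closed_star_set star_disjoint[OF kp]] by auto
  interpret finite_measure "\<sigma> (Suc k)" using finite_\<sigma> kp .
  have "norm (f k j z) \<le> measure (\<sigma> (Suc k)) (space (\<sigma> (Suc k))) * (C / d)" if z: "z \<in> S k" for z
  proof -
    have bound: "norm (1 / (z - t) * f (Suc k) j t) \<le> C / d" if t: "t \<in> S (Suc k)" for t
    proof -
      have "norm (f (Suc k) j t) / norm (z - t) \<le> C / d"
        using C[OF t] d(1) d(2)[OF z t] by (intro frac_le) (auto simp: dist_norm intro: order.trans[OF norm_ge_zero])
      then show ?thesis by (simp add: norm_mult norm_divide)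
    qed
    have int: "integrable (\<sigma> (Suc k)) (\<lambda>t. 1 / (z - t) * f (Suc k) j t)"
      by (rule integrable_bounded[OF kp]) (measurable, rule bound)
    have "norm (f k j z) \<le> (\<integral>t. norm (1 / (z - t) * f (Suc k) j t) \<partial>\<sigma> (Suc k))"
      using k by (simp only: nikishin_density.simps[of _ k] if_True integral_norm_bound)
    also have "\<dots> \<le> (\<integral>t. C / d \<partial>\<sigma> (Suc k))"
    proof (intro integral_mono_AE integrable_norm int)
      show "AE t in \<sigma> (Suc k). norm (1 / (z - t) * f (Suc k) j t) \<le> C / d"
        using AE_\<sigma>[OF kp] by eventually_elim (rule bound)
    qed simp
    finally show ?thesis by simp
  qed
  then show ?case by blast
qed

lemma integrable_f:
  assumes "j < p" "k \<le> j" "g \<in> borel_measurable borel" "continuous_on (S k) g"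
  shows "integrable (\<sigma> k) (\<lambda>z. g z * f k j z)"
proof -
  obtain C where C: "\<And>z. z \<in> S k \<Longrightarrow> norm (f k j z) \<le> C" using f_bounded[OF assms(1,2)] by blast
  have "compact (g ` S k)" using assms(4) compact_star_set by (rule compact_continuous_image)
  then obtain B where B: "\<And>z. z \<in> S k \<Longrightarrow> norm (g z) \<le> B"
    by (meson bounded_iff compact_imp_bounded imageI)
  have [measurable]: "f k j \<in> borel_measurable borel" "g \<in> borel_measurable borel"
    using measurable_f[OF assms(1)] assms(3) by auto
  show ?thesis
  proof (rule integrable_bounded[where C = "B * C"])
    show "k < p" using assms by simp
    show "norm (g z * f k j z) \<le> B * C" if "z \<in> S k" for z
      unfolding norm_mult using B[OF that] C[OF that] by (intro mult_mono) (auto intro: order.trans[OF norm_ge_zero])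
  qed measurable
qed

text \<open>Write \<open>1 / (z - t)\<close> as the sum of \<open>z ^ (p - i) * t ^ i\<close> over
  \<open>i \<le> p\<close>, divided by \<open>z ^ (p + 1) - t ^ (p + 1)\<close>. The denominator is
  invariant under rotation of \<open>t\<close>, so covariance kills every term except the one with
  \<open>i = j - k - 1\<close>.\<close>

lemma f_eq_line_density:
  "j < p \<Longrightarrow> k \<le> j \<Longrightarrow> z \<in> S k \<Longrightarrow>
     z ^ (j - k) * f k j z = complex_of_real (line_density M k j (\<pi>\<^sub>r z))"
proof (induction "j - k" arbitrary: k z)
  case 0
  then have "k = j" by linarith
  then show ?case by (simp add: nikishin_density.simps line_density.simps)
next
  case (Suc n)
  then have k: "k < j" by linarith
  have kp: "Suc k < p" using k Suc.prems by simp
  define m where "m = j - Suc k"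
  have m: "j - k = Suc m" "m \<le> p" using k \<open>j < p\<close> by (auto simp: m_def)
  have f_meas [measurable]: "f (Suc k) j \<in> borel_measurable borel" by (rule measurable_f[OF \<open>j < p\<close>])
  have l_meas [measurable]: "line_density M (Suc k) j \<in> borel_measurable borel"
    by (rule line.measurable_line_density[OF \<open>j < p\<close>])
  have pm [measurable]: "(\<lambda>z::complex. z ^ n) \<in> borel_measurable borel" for n by measurable
  note [measurable_cong] = sets_\<sigma>[OF kp]
  have IH: "t ^ m * f (Suc k) j t = complex_of_real (line_density M (Suc k) j (\<pi>\<^sub>r t))" if "t \<in> S (Suc k)" for t
    unfolding m_def by (rule Suc.hyps(1)) (use Suc k that in \<open>linarith | blast\<close>)+
  define D where "D t = z ^ (p + 1) - t ^ (p + 1)" for t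
  have D0: "D t \<noteq> 0" if "t \<in> S (Suc k)" for t
  proof
    assume "D t = 0"
    then have "z \<in> S (Suc k)" using that by (auto simp: star_set_def D_def)
    then show False using star_disjoint[OF kp] \<open>z \<in> S k\<close> by blast
  qed
  have D_meas [measurable]: "D \<in> borel_measurable borel" unfolding D_def[abs_def] by measurable
  have D_cont: "continuous_on A D" for A unfolding D_def[abs_def] by (intro continuous_intros)
  have D_rot: "D (\<omega> * t) = D t" for t
    unfolding D_def power_mult_distrib omega_power by simp
  define h where "h i t = t ^ i / D t * f (Suc k) j t" for i t
  have h_meas: "h i \<in> borel_measurable borel" for i unfolding h_def[abs_def] by measurable
  have h_int: "integrable (\<sigma> (Suc k)) (h i)" for i
    unfolding h_def[abs_def] using \<open>j < p\<close> k
    by (intro integrable_f) (auto intro!: continuous_intros D_cont D0)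
  have h_zero: "(\<integral>t. h i t \<partial>\<sigma> (Suc k)) = 0" if "i \<le> p" "i \<noteq> m" for i
  proof (rule integral_zero_if_covariant[OF kp h_meas _ m(2) that(1)])
    fix t
    have "h i (\<omega> * t) * \<omega> ^ m = \<omega> ^ i * (t ^ i / D t * (f (Suc k) j (\<omega> * t) * \<omega> ^ m))"
      by (simp add: h_def D_rot power_mult_distrib)
    then show "h i (\<omega> * t) * \<omega> ^ m = \<omega> ^ i * h i t"
      unfolding m_def using f_rotation[OF \<open>j < p\<close>, of "Suc k" t] k by (simp add: h_def)
  qed (use that in auto)
  have "f k j z = (\<integral>t. 1 / (z - t) * f (Suc k) j t \<partial>\<sigma> (Suc k))"
    using k by (simp add: nikishin_density.simps[of _ k])
  also have "\<dots> = (\<integral>t. (\<Sum>i<p + 1. z ^ (p - i) * h i t) \<partial>\<sigma> (Suc k))"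
  proof (rule integral_cong_AE)
    show "AE t in \<sigma> (Suc k). 1 / (z - t) * f (Suc k) j t = (\<Sum>i<p + 1. z ^ (p - i) * h i t)"
      using AE_\<sigma>[OF kp]
    proof eventually_elim
      case (elim t)
      have zt: "z - t \<noteq> 0" using elim star_disjoint[OF kp] \<open>z \<in> S k\<close> by auto
      have "D t = (z - t) * (\<Sum>i<p + 1. t ^ i * z ^ (p - i))"
      proof -
        have "t ^ (p + 1) - z ^ (p + 1) = (t - z) * (\<Sum>i<p + 1. z ^ (p + 1 - Suc i) * t ^ i)"
          by (rule power_diff_sumr2)
        then have "D t = (z - t) * (\<Sum>i<p + 1. z ^ (p + 1 - Suc i) * t ^ i)"
          unfolding D_def by (metis minus_diff_eq mult_minus_left)
        then show ?thesis by (simp add: mult.commute)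
      qed
      then have "1 / (z - t) = (\<Sum>i<p + 1. t ^ i * z ^ (p - i)) / D t"
        using zt D0[OF elim] by (simp add: divide_simps)
      then have "1 / (z - t) * f (Suc k) j t = (\<Sum>i<p + 1. t ^ i * z ^ (p - i)) / D t * f (Suc k) j t"
        by (simp only:)
      also have "\<dots> = (\<Sum>i<p + 1. z ^ (p - i) * h i t)"
        unfolding h_def sum_divide_distrib sum_distrib_right by (intro sum.cong refl) simp
      finally show ?case .
    qed
    show "(\<lambda>t. \<Sum>i<p + 1. z ^ (p - i) * h i t) \<in> borel_measurable (\<sigma> (Suc k))"
      using h_meas by measurable
  qed measurable
  also have "\<dots> = (\<Sum>i<p + 1. z ^ (p - i) * (\<integral>t. h i t \<partial>\<sigma> (Suc k)))"
    by (subst Bochner_Integration.integral_sum) (auto intro: h_int)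
  also have "\<dots> = (\<Sum>i\<in>{m}. z ^ (p - i) * (\<integral>t. h i t \<partial>\<sigma> (Suc k)))"
    by (rule sum.mono_neutral_right) (use m h_zero in auto)
  also have "\<dots> = z ^ (p - m) * (\<integral>t. h m t \<partial>\<sigma> (Suc k))" by simp
  also have "(\<integral>t. h m t \<partial>\<sigma> (Suc k)) =
      (\<integral>t. complex_of_real (line_density M (Suc k) j (\<pi>\<^sub>r t) / (\<pi>\<^sub>r z - \<pi>\<^sub>r t)) \<partial>\<sigma> (Suc k))"
  proof (rule integral_cong_AE)
    show "AE t in \<sigma> (Suc k). h m t = complex_of_real (line_density M (Suc k) j (\<pi>\<^sub>r t) / (\<pi>\<^sub>r z - \<pi>\<^sub>r t))"
      using AE_\<sigma>[OF kp]
    proof eventually_elim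
      case (elim t)
      have "D t = complex_of_real (\<pi>\<^sub>r z - \<pi>\<^sub>r t)"
        unfolding D_def of_real_diff star_setD(2)[OF elim] star_setD(2)[OF \<open>z \<in> S k\<close>] ..
      moreover have "h m t = t ^ m * f (Suc k) j t / D t" by (simp add: h_def)
      ultimately show ?case unfolding IH[OF elim] by (simp only: of_real_divide)
    qed
  qed (use h_meas in measurable)
  also have "\<dots> = complex_of_real (\<integral>t. line_density M (Suc k) j (\<pi>\<^sub>r t) / (\<pi>\<^sub>r z - \<pi>\<^sub>r t) \<partial>\<sigma> (Suc k))"
    by (rule integral_complex_of_real)
  also have "(\<integral>t. line_density M (Suc k) j (\<pi>\<^sub>r t) / (\<pi>\<^sub>r z - \<pi>\<^sub>r t) \<partial>\<sigma> (Suc k)) =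
      (\<integral>x. line_density M (Suc k) j x / (\<pi>\<^sub>r z - x) \<partial>M (Suc k))"
    unfolding M_def by (rule integral_distr[symmetric, OF measurable_\<pi>[OF kp]]) (use l_meas[unfolded M_def[abs_def]] in measurable)
  finally have fz: "f k j z = z ^ (p - m) * complex_of_real (\<integral>x. line_density M (Suc k) j x / (\<pi>\<^sub>r z - x) \<partial>M (Suc k))" .
  \<comment> \<open>The normalising power and the surviving power of \<open>z\<close> combine to
    \<open>z ^ (p + 1)\<close>, which is the leading factor \<open>x\<close> in
    \<open>line_density\<close>.\<close>
  have "z ^ Suc m * z ^ (p - m) = complex_of_real (\<pi>\<^sub>r z)"
    unfolding star_setD(2)[OF \<open>z \<in> S k\<close>] using m(2) by (simp flip: power_add power_Suc)
  then show ?case unfolding m(1) fz using k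
    by (simp only: mult.assoc[symmetric] line_density.simps[of M k] if_True of_real_mult)
qed

end

subsection \<open>Positivity of the recurrence coefficients\<close>

context star_nikishin begin

section \<open>Moments and the orthogonality conditions\<close>

definition moment :: "nat \<Rightarrow> nat \<Rightarrow> complex" where
  "moment j m = (\<integral>z. z ^ m * f 0 j z \<partial>\<sigma> 0)"

text \<open>For \<open>m = (p + 1) * e + j\<close> the power \<open>z ^ j\<close> turns the density
  into its line version and leaves \<open>x ^ e\<close>; for any other residue the integrand is
  covariant with a nontrivial factor.\<close>

lemma moment_eq:
  assumes j: "j < p"
  shows "moment j m = complex_of_real
    (if m mod (p + 1) = j then \<integral>x. line.u 0 (p * (m div (p + 1)) + j) x \<partial>M 0 else 0)"
proof (cases "m mod (p + 1) = j")
  case True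
  have p0: "0 < p" using j by simp
  note [measurable_cong] = sets_\<sigma>[OF p0]
  note [measurable] = measurable_f[OF j] line.measurable_u[OF p0] measurable_\<pi>[OF p0]
  define e where "e = m div (p + 1)"
  have m: "m = (p + 1) * e + j" unfolding e_def True[symmetric] by (simp only: mult_div_mod_eq)
  have "moment j m = (\<integral>z. complex_of_real (line.u 0 (p * e + j) (\<pi>\<^sub>r z)) \<partial>\<sigma> 0)"
    unfolding moment_def
  proof (rule integral_cong_AE)
    show "AE z in \<sigma> 0. z ^ m * f 0 j z = complex_of_real (line.u 0 (p * e + j) (\<pi>\<^sub>r z))"
      using AE_\<sigma>[OF p0]
    proof eventually_elim
      case (elim z)
      have "z ^ m * f 0 j z = (z ^ (p + 1)) ^ e * (z ^ (j - 0) * f 0 j z)"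
        unfolding m power_add power_mult by (simp only: mult.assoc diff_zero)
      also have "\<dots> = complex_of_real (\<pi>\<^sub>r z ^ e * line_density M 0 j (\<pi>\<^sub>r z))"
        unfolding f_eq_line_density[OF j le0 elim] of_real_mult of_real_power star_setD(2)[OF elim] ..
      finally show ?case using j by (simp add: line.u_def)
    qed
  qed measurable
  also have "\<dots> = complex_of_real (\<integral>z. line.u 0 (p * e + j) (\<pi>\<^sub>r z) \<partial>\<sigma> 0)"
    by (rule integral_complex_of_real)
  also have "(\<integral>z. line.u 0 (p * e + j) (\<pi>\<^sub>r z) \<partial>\<sigma> 0) = (\<integral>x. line.u 0 (p * e + j) x \<partial>M 0)"
    unfolding M_def by (rule integral_distr[symmetric, OF measurable_\<pi>[OF p0]])
      (rule line.measurable_u[OF p0, unfolded M_def[abs_def]])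
  finally show ?thesis using True by (simp only: e_def if_True simp_thms)
next
  case False
  have p0: "0 < p" using j by simp
  have f_meas [measurable]: "f 0 j \<in> borel_measurable borel" by (rule measurable_f[OF j])
  have "moment j m = 0" unfolding moment_def
  proof (rule integral_zero_if_covariant[OF p0, of _ j "m mod (p + 1)"])
    fix z
    have "(\<omega> * z) ^ m * f 0 j (\<omega> * z) * \<omega> ^ j = \<omega> ^ m * (z ^ m * (f 0 j (\<omega> * z) * \<omega> ^ (j - 0)))"
      by (simp add: power_mult_distrib)
    also have "\<dots> = \<omega> ^ m * (z ^ m * f 0 j z)" by (simp only: f_rotation[OF j le0])
    finally show "(\<omega> * z) ^ m * f 0 j (\<omega> * z) * \<omega> ^ j = \<omega> ^ (m mod (p + 1)) * (z ^ m * f 0 j z)"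
      by (simp only: omega_mod[symmetric])
  next
    have "m mod (p + 1) < p + 1" by (rule mod_less_divisor) simp
    then show "m mod (p + 1) \<le> p" by linarith
  qed (use False j in auto)
  then show ?thesis using False by (simp only: if_False of_real_0)
qed

lemma integrable_poly_f:
  assumes "j < p"
  shows "integrable (\<sigma> 0) (\<lambda>z. poly P z * z ^ l * f 0 j z)"
  by (rule integrable_f[OF assms le0])
    (intro borel_measurable_continuous_onI continuous_intros)+

lemma nikishin_integral_eq:
  assumes "j < p" "degree P \<le> n"
  shows "nikishin_integral \<sigma> 0 j (\<lambda>z. poly P z * z ^ l) = (\<Sum>i\<le>n. coeff P i * moment j (i + l))"
proof -
  have pz: "poly P z = (\<Sum>i\<le>n. coeff P i * z ^ i)" for z
    unfolding poly_altdef by (rule sum.mono_neutral_left) (use assms(2) in \<open>auto simp: coeff_eq_0\<close>)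
  have int: "integrable (\<sigma> 0) (\<lambda>z. coeff P i * (z ^ (i + l) * f 0 j z))" for i
    using integrable_poly_f[OF assms(1), of 1 "i + l"] by (intro integrable_mult_right) simp
  have "nikishin_integral \<sigma> 0 j (\<lambda>z. poly P z * z ^ l) =
      (\<integral>z. (\<Sum>i\<le>n. coeff P i * (z ^ (i + l) * f 0 j z)) \<partial>\<sigma> 0)"
    unfolding nikishin_integral_def pz by (simp add: sum_distrib_left sum_distrib_right power_add mult_ac)
  also have "\<dots> = (\<Sum>i\<le>n. coeff P i * moment j (i + l))"
    unfolding moment_def by (subst Bochner_Integration.integral_sum) (auto intro: int)
  finally show ?thesis .
qed

text \<open>The pairs \<open>(j, l)\<close> are numbered by \<open>p * l + j\<close>, so there are
  exactly \<open>n\<close> linear conditions.\<close>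

lemma multi_orthogonal_iff:
  "multi_orthogonal p \<sigma> n P \<longleftrightarrow>
    (\<forall>j<p. \<forall>l. p * l + j < n \<longrightarrow> nikishin_integral \<sigma> 0 j (\<lambda>z. poly P z * z ^ l) = 0)"
proof -
  have "int l \<le> (int n - int j - 1) div int p \<longleftrightarrow> p * l + j < n" for j l
  proof -
    have "int l \<le> (int n - int j - 1) div int p \<longleftrightarrow> int l * int p \<le> int n - int j - 1"
    proof
      assume "int l \<le> (int n - int j - 1) div int p"
      then have "int l * int p \<le> (int n - int j - 1) div int p * int p" by (rule mult_right_mono) simp
      also have "\<dots> \<le> int n - int j - 1"
        using pos_mod_sign[of "int p" "int n - int j - 1"] div_mult_mod_eq[of "int n - int j - 1" "int p"] p_pos
        by linarith
      finally show "int l * int p \<le> int n - int j - 1" .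
    next
      assume "int l * int p \<le> int n - int j - 1"
      from zdiv_mono1[OF this, of "int p"] show "int l \<le> (int n - int j - 1) div int p"
        using p_pos by simp
    qed
    also have "\<dots> \<longleftrightarrow> int (p * l + j) < int n" by (simp add: algebra_simps) linarith
    finally show ?thesis by (simp only: of_nat_less_iff)
  qed
  then show ?thesis unfolding multi_orthogonal_def by simp
qed

text \<open>The \<open>n\<close> conditions on \<open>n + 1\<close> coefficients have a nonzero
  solution of degree at most \<open>n\<close>; made monic, it competes with \<open>P\<close> for the
  least degree.\<close>

lemma degree_multi_orthogonal_le:
  assumes "multi_orthogonal_poly p \<sigma> n P"
  shows "degree P \<le> n"
proof -
  obtain x where x: "\<exists>k\<le>n. x k \<noteq> 0" "\<forall>t<n. (\<Sum>k\<le>n. moment (t mod p) (k + t div p) * x k) = 0"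
    using underdetermined_system[of n "\<lambda>t k. moment (t mod p) (k + t div p)"] by blast
  define T where "T = (\<Sum>k\<le>n. monom (x k) k)"
  have coeff_T: "coeff T k = (if k \<le> n then x k else 0)" for k
    by (simp add: T_def coeff_sum)
  have "degree T \<le> n" by (rule degree_le) (simp add: coeff_T)
  have "T \<noteq> 0" using x(1) coeff_T by (metis coeff_0)
  define T' where "T' = smult (inverse (lead_coeff T)) T"
  have deg: "degree T' \<le> n" using \<open>degree T \<le> n\<close> by (simp add: T'_def)
  have "multi_orthogonal p \<sigma> n T'" unfolding multi_orthogonal_iff
  proof (intro allI impI)
    fix j l assume j: "j < p" and l: "p * l + j < n"
    have t: "(p * l + j) mod p = j" "(p * l + j) div p = l" using j by simp_all
    have "nikishin_integral \<sigma> 0 j (\<lambda>z. poly T' z * z ^ l) =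
        inverse (lead_coeff T) * (\<Sum>k\<le>n. moment j (k + l) * x k)"
      unfolding nikishin_integral_eq[OF j deg]
      by (simp add: T'_def coeff_T sum_distrib_left mult_ac)
    also have "\<dots> = 0" using x(2)[rule_format, OF l] unfolding t by simp
    finally show "nikishin_integral \<sigma> 0 j (\<lambda>z. poly T' z * z ^ l) = 0" .
  qed
  moreover have "lead_coeff T' = 1" using \<open>T \<noteq> 0\<close> by (simp add: T'_def)
  ultimately have "\<not> degree T' < degree P"
    using assms by (auto simp: multi_orthogonal_poly_def is_arg_min_def)
  then show ?thesis using deg by simp
qed

text \<open>Real parts are taken because the coefficients of \<open>P\<close> are complex a priori;
  the moments are real, so orthogonality passes to the real parts.\<close>

definition component :: "nat \<Rightarrow> complex poly \<Rightarrow> real poly" where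
  "component c P = (\<Sum>i\<le>degree P. if i mod (p + 1) = c then monom (Re (coeff P i)) (i div (p + 1)) else 0)"

lemma coeff_component:
  assumes "c \<le> p"
  shows "coeff (component c P) k = Re (coeff P ((p + 1) * k + c))"
proof -
  have iff: "i mod (p + 1) = c \<and> i div (p + 1) = k \<longleftrightarrow> i = (p + 1) * k + c" for i
  proof
    assume "i mod (p + 1) = c \<and> i div (p + 1) = k"
    then show "i = (p + 1) * k + c" by (metis mult_div_mod_eq)
  next
    assume "i = (p + 1) * k + c"
    then show "i mod (p + 1) = c \<and> i div (p + 1) = k" using assms by (simp del: mult_Suc add: less_Suc_eq_le)
  qed
  have "coeff (component c P) k =
      (\<Sum>i\<le>degree P. if i mod (p + 1) = c \<and> i div (p + 1) = k then Re (coeff P i) else 0)"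
    unfolding component_def coeff_sum by (rule sum.cong) auto
  also have "\<dots> = (\<Sum>i\<le>degree P. if i = (p + 1) * k + c then Re (coeff P i) else 0)"
    unfolding iff ..
  also have "\<dots> = Re (coeff P ((p + 1) * k + c))"
    by (subst sum.delta) (auto simp: coeff_eq_0 simp del: mult_Suc)
  finally show ?thesis .
qed

text \<open>The moment of order \<open>i + l\<close> survives only for \<open>i + l\<close>
  congruent to \<open>j\<close>, that is, for \<open>i\<close> congruent to \<open>c\<close> modulo
  \<open>p + 1\<close>.\<close>

lemma Re_nikishin_integral:
  assumes c: "c \<le> p" and j: "j < p" and cl: "(c + l) mod (p + 1) = j"
  shows "Re (nikishin_integral \<sigma> 0 j (\<lambda>z. poly P z * z ^ l)) =
    (\<integral>x. poly (component c P) x * line.u 0 (p * ((c + l) div (p + 1)) + j) x \<partial>M 0)"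
proof -
  have p0: "0 < p" using j by simp
  define e where "e = (c + l) div (p + 1)"
  have cl_eq: "c + l = (p + 1) * e + j" unfolding e_def cl[symmetric] by (simp only: mult_div_mod_eq)
  define U where "U i x = x ^ i * line.u 0 (p * e + j) x" for i x
  have dm: "(p * n + j) div p = n" "(p * n + j) mod p = j" for n using j by simp_all
  have U: "line.u 0 (p * (i + e) + j) x = U i x" for i x
    unfolding U_def line.u_def diff_zero dm power_add by (simp only: mult.assoc)
  have U_int: "integrable (M 0) (U i)" for i
    unfolding U_def[abs_def] using p0
    by (intro line.integrable_M) (auto intro!: continuous_intros line.continuous_u)
  have mod_iff: "(i + l) mod (p + 1) = j \<longleftrightarrow> i mod (p + 1) = c" for i
  proof
    assume "i mod (p + 1) = c"
    then have "(i + l) mod (p + 1) = (c + l) mod (p + 1)" by (metis mod_add_left_eq)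
    then show "(i + l) mod (p + 1) = j" using cl by simp
  next
    assume *: "(i + l) mod (p + 1) = j"
    have "(i + l) mod (p + 1) = (c + l) mod (p + 1)" using * cl by simp
    then have "i mod (p + 1) = c mod (p + 1)"
    proof (cases "c \<le> i")
      case True
      then show ?thesis using \<open>(i + l) mod (p + 1) = (c + l) mod (p + 1)\<close>
        by (metis add_le_cancel_right diff_add_inverse2 diff_diff_left diff_cancel2 mod_eq_dvd_iff_nat)
    next
      case False
      then show ?thesis using \<open>(i + l) mod (p + 1) = (c + l) mod (p + 1)\<close>
        by (metis add_le_cancel_right diff_cancel2 mod_eq_dvd_iff_nat nat_le_linear)
    qed
    then show "i mod (p + 1) = c" using c by simp
  qed
  have div_eq: "(i + l) div (p + 1) = i div (p + 1) + e" if "i mod (p + 1) = c" for i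
  proof -
    have "i + l = (p + 1) * (i div (p + 1)) + (c + l)"
      using mult_div_mod_eq[of "p + 1" i] that by linarith
    then have "i + l = (p + 1) * (i div (p + 1) + e) + j" using cl_eq by (simp only: distrib_left add.assoc)
    then show ?thesis using j by (simp only:) (simp del: mult_Suc)
  qed
  have "Re (nikishin_integral \<sigma> 0 j (\<lambda>z. poly P z * z ^ l)) =
      (\<Sum>i\<le>degree P. Re (coeff P i) * (if (i + l) mod (p + 1) = j
        then \<integral>x. line.u 0 (p * ((i + l) div (p + 1)) + j) x \<partial>M 0 else 0))"
    unfolding nikishin_integral_eq[OF j order.refl] moment_eq[OF j] Re_sum by simp
  also have "\<dots> = (\<Sum>i\<le>degree P. if i mod (p + 1) = c
      then \<integral>x. Re (coeff P i) * U (i div (p + 1)) x \<partial>M 0 else 0)"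
  proof (rule sum.cong)
    fix i
    show "Re (coeff P i) * (if (i + l) mod (p + 1) = j
        then \<integral>x. line.u 0 (p * ((i + l) div (p + 1)) + j) x \<partial>M 0 else 0) =
      (if i mod (p + 1) = c then \<integral>x. Re (coeff P i) * U (i div (p + 1)) x \<partial>M 0 else 0)"
      unfolding mod_iff by (cases "i mod (p + 1) = c") (simp_all only: div_eq U if_True if_False integral_mult_right_zero mult_zero_right simp_thms)
  qed simp
  also have "\<dots> = (\<Sum>i\<le>degree P. \<integral>x. (if i mod (p + 1) = c then Re (coeff P i) * U (i div (p + 1)) x else 0) \<partial>M 0)"
    by (rule sum.cong) auto
  also have "\<dots> = (\<integral>x. (\<Sum>i\<le>degree P. if i mod (p + 1) = c then Re (coeff P i) * U (i div (p + 1)) x else 0) \<partial>M 0)"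
  proof (rule Bochner_Integration.integral_sum[symmetric])
    show "integrable (M 0) (\<lambda>x. if i mod (p + 1) = c then Re (coeff P i) * U (i div (p + 1)) x else 0)" for i
      using U_int[of "i div (p + 1)"] by (cases "i mod (p + 1) = c") (simp_all only: if_True if_False integrable_zero integrable_mult_right simp_thms)
  qed
  also have "\<dots> = (\<integral>x. poly (component c P) x * line.u 0 (p * e + j) x \<partial>M 0)"
  proof (rule Bochner_Integration.integral_cong)
    fix x
    show "(\<Sum>i\<le>degree P. if i mod (p + 1) = c then Re (coeff P i) * U (i div (p + 1)) x else 0) =
      poly (component c P) x * line.u 0 (p * e + j) x"
      unfolding component_def poly_sum sum_distrib_right
      by (rule sum.cong) (auto simp: U_def poly_monom)
  qed simp
  finally show ?thesis by (simp only: e_def)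
qed

lemma component_orthogonal:
  assumes orth: "multi_orthogonal p \<sigma> n P" and c: "c \<le> p" "c \<le> k" and k: "(p + 1) * k < n + p * c"
  shows "(\<integral>x. poly (component c P) x * line.u 0 k x \<partial>M 0) = 0"
proof -
  define j where "j = k mod p"
  define e where "e = k div p"
  have j: "j < p" using p_pos by (simp add: j_def)
  have k_eq: "k = p * e + j" by (simp add: j_def e_def)
  \<comment> \<open>This exponent makes residue \<open>c\<close> pair with the function of index
    \<open>k\<close>. It gives \<open>p * l + j = (p + 1) * k - p * c\<close>, the source of the
    bound on \<open>k\<close>; and \<open>c \<le> k\<close> keeps the subtraction from being
    truncated.\<close>
  define l where "l = (p + 1) * e + j - c"
  have cl: "c + l = (p + 1) * e + j" using c(2) k_eq by (simp add: l_def)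
  have dm: "(c + l) mod (p + 1) = j" "(c + l) div (p + 1) = e"
    unfolding cl using j by (simp_all del: mult_Suc)
  have "p * (c + l) + j = (p + 1) * k" unfolding cl k_eq by (simp add: algebra_simps)
  then have "p * l + j < n" using k by (simp add: algebra_simps)
  then have "nikishin_integral \<sigma> 0 j (\<lambda>z. poly P z * z ^ l) = 0"
    using orth j unfolding multi_orthogonal_iff by blast
  then show ?thesis using Re_nikishin_integral[OF c(1) j dm(1), of P] unfolding dm(2) k_eq[symmetric] by simp
qed

text \<open>If the degree were smaller than \<open>n\<close>, the component with the residue of that
  degree would have degree \<open>D\<close> and still be orthogonal to \<open>D + 1\<close>
  functions.\<close>

lemma degree_multi_orthogonal:
  assumes P: "multi_orthogonal_poly p \<sigma> n P"
  shows "degree P = n"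
proof (rule ccontr)
  assume "degree P \<noteq> n"
  then have less: "degree P < n" using degree_multi_orthogonal_le[OF P] by simp
  have lead: "lead_coeff P = 1" and orth: "multi_orthogonal p \<sigma> n P"
    using P by (auto simp: multi_orthogonal_poly_def is_arg_min_def)
  define c where "c = degree P mod (p + 1)"
  define D where "D = degree P div (p + 1)"
  have deg: "degree P = (p + 1) * D + c" by (simp only: c_def D_def mult_div_mod_eq)
  have "degree P mod (p + 1) < p + 1" by (rule mod_less_divisor) simp
  then have c: "c \<le> p" by (simp add: c_def)
  have "coeff (component c P) D = 1" using lead unfolding coeff_component[OF c] deg by simp
  then have nz: "component c P \<noteq> 0" by auto
  have "degree (component c P) \<le> D"
  proof (rule degree_le, intro allI impI)
    fix k assume "D < k"
    then have "(p + 1) * D < (p + 1) * k" by (simp del: mult_Suc)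
    then have "degree P < (p + 1) * k + c" unfolding deg by linarith
    then show "coeff (component c P) k = 0" by (simp only: coeff_component[OF c] coeff_eq_0 zero_complex.sel)
  qed
  moreover have "degree (component c P) \<ge> Suc D"
  proof (rule line.orthogonal_degree[OF _ c nz])
    fix k assume "k < Suc D"
    then have "(p + 1) * k \<le> (p + 1) * D" by (intro mult_left_mono) auto
    then have "(p + 1) * k + c < n" using less deg by linarith
    then have "(p + 1) * (c + k) < n + p * c" by (simp add: algebra_simps)
    then show "(\<integral>x. poly (component c P) x * line.u 0 (c + k) x \<partial>M 0) = 0"
      by (intro component_orthogonal[OF orth c]) simp_all
  qed (use p_pos in simp)
  ultimately show False by simp
qed

text \<open>The first condition beyond those imposed on \<open>P\<close> has
  \<open>p * l + j = n = (p + 1) * D + c\<close>, and on the line this is the pairing with index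
  \<open>c + D\<close>, the first one beyond the orthogonality of the component.\<close>

lemma leading_integral_sign:
  assumes P: "multi_orthogonal_poly p \<sigma> n P"
  shows "line.R 0 (n mod (p + 1)) (n div (p + 1)) *
    Re (nikishin_integral \<sigma> 0 (n mod p) (\<lambda>z. poly P z * z ^ (n div p))) > 0"
proof -
  have lead: "lead_coeff P = 1" and orth: "multi_orthogonal p \<sigma> n P"
    using P by (auto simp: multi_orthogonal_poly_def is_arg_min_def)
  note deg = degree_multi_orthogonal[OF P]
  define c where "c = n mod (p + 1)"
  define D where "D = n div (p + 1)"
  define j where "j = n mod p"
  define l where "l = n div p"
  have n1: "n = (p + 1) * D + c" by (simp only: c_def D_def mult_div_mod_eq)
  have n2: "n = p * l + j" by (simp only: l_def j_def mult_div_mod_eq)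
  have "n mod (p + 1) < p + 1" by (rule mod_less_divisor) simp
  then have c: "c \<le> p" by (simp add: c_def)
  have j: "j < p" using p_pos by (simp add: j_def)
  have coeff_D: "coeff (component c P) D = 1" using lead unfolding coeff_component[OF c] deg n1[symmetric] by simp
  have deg_c: "degree (component c P) = D"
  proof (rule antisym)
    show "degree (component c P) \<le> D"
    proof (rule degree_le, intro allI impI)
      fix k assume "D < k"
      then have "(p + 1) * D < (p + 1) * k" by (simp del: mult_Suc)
      then have "degree P < (p + 1) * k + c" unfolding deg using n1 by linarith
      then show "coeff (component c P) k = 0" by (simp only: coeff_component[OF c] coeff_eq_0 zero_complex.sel)
    qed
    show "D \<le> degree (component c P)" using coeff_D by (intro le_degree) simp
  qed
  have pos: "line.R 0 c D * (\<integral>x. poly (component c P) x * line.u 0 (c + D) x \<partial>M 0) > 0"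
  proof (rule line.orthogonal_sign[OF _ c deg_c])
    show "lead_coeff (component c P) = 1" using coeff_D deg_c by simp
    fix k assume "k < D"
    then have "(p + 1) * k < (p + 1) * D" by (simp del: mult_Suc)
    then have "(p + 1) * k + c < n" using n1 by linarith
    then have "(p + 1) * (c + k) < n + p * c" by (simp add: algebra_simps)
    then show "(\<integral>x. poly (component c P) x * line.u 0 (c + k) x \<partial>M 0) = 0"
      by (intro component_orthogonal[OF orth c]) simp_all
  qed (use p_pos in simp)
  have sum: "c + l + (p + 1) * D = (p + 1) * l + j" using n1 n2 by (simp add: algebra_simps)
  have "(c + l) mod (p + 1) = (c + l + (p + 1) * D) mod (p + 1)" by (simp only: mod_mult_self2)
  also have "\<dots> = j" unfolding sum using j by (simp del: mult_Suc)
  finally have cl: "(c + l) mod (p + 1) = j" .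
  define e where "e = (c + l) div (p + 1)"
  have cl_eq: "c + l = (p + 1) * e + j" unfolding e_def cl[symmetric] by (simp only: mult_div_mod_eq)
  have "(p + 1) * (e + D) = (p + 1) * l" using sum cl_eq unfolding distrib_left by linarith
  then have "e + D = l" by (simp del: mult_Suc)
  then have k: "p * e + j = c + D" using cl_eq by (simp add: algebra_simps)
  have "Re (nikishin_integral \<sigma> 0 j (\<lambda>z. poly P z * z ^ l)) =
      (\<integral>x. poly (component c P) x * line.u 0 (c + D) x \<partial>M 0)"
    unfolding Re_nikishin_integral[OF c j cl] e_def[symmetric] k ..
  then show ?thesis using pos by (simp only: c_def D_def j_def l_def)
qed

text \<open>The interval of level 0 lies on the positive side, so with \<open>e = 1\<close> the step
  identity (for \<open>c < p\<close>) and the wrap identity (for \<open>c = p\<close>) both give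
  equal signs.\<close>

lemma leading_sign_ratio:
  assumes "n \<ge> p"
  shows "line.R 0 (n mod (p + 1)) (n div (p + 1)) *
    line.R 0 ((n - p) mod (p + 1)) ((n - p) div (p + 1)) = 1"
proof -
  define c where "c = n mod (p + 1)"
  define D where "D = n div (p + 1)"
  have n: "n = (p + 1) * D + c" by (simp only: c_def D_def mult_div_mod_eq)
  have "n mod (p + 1) < p + 1" by (rule mod_less_divisor) simp
  then have "c < p + 1" by (simp only: c_def)
  then consider "c = p" | "c < p" by linarith
  then show ?thesis
  proof cases
    case 1
    then have "n - p = (p + 1) * D" using n by simp
    then have "(n - p) mod (p + 1) = 0" "(n - p) div (p + 1) = D" by (simp_all del: mult_Suc)
    then show ?thesis using sign_pattern_wrap[OF p_pos, of 1 D] sign_pattern_cases[of 1 p 0 D]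
      unfolding c_def[symmetric] D_def[symmetric] 1 by (auto simp: line.R_def)
  next
    case 2
    then obtain D' where D: "D = Suc D'" using assms n by (cases D) auto
    then have "n - p = (p + 1) * D' + Suc c" using n 2 by simp
    moreover have "Suc c < p + 1" using 2 by simp
    moreover have "((p + 1) * D' + r) mod (p + 1) = r" "((p + 1) * D' + r) div (p + 1) = D'"
      if "r < p + 1" for r using that by (simp_all del: mult_Suc)
    ultimately have "(n - p) mod (p + 1) = Suc c" "(n - p) div (p + 1) = D'" by metis+
    then show ?thesis using sign_pattern_step[of 1 c p D'] 2
      unfolding c_def[symmetric] D_def[symmetric] D by (simp add: line.R_def)
  qed
qed

theorem recurrence_coefficient_pos:
  fixes a :: "nat \<Rightarrow> real"
  assumes Q: "\<And>n. multi_orthogonal_poly p \<sigma> n (Q n)"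
    and rec: "\<And>n z. n \<ge> p \<Longrightarrow>
      z * poly (Q n) z = poly (Q (Suc n)) z + of_real (a n) * poly (Q (n - p)) z"
    and n: "n \<ge> p"
  shows "a n > 0"
proof -
  define H where "H n = nikishin_integral \<sigma> 0 (n mod p) (\<lambda>z. poly (Q n) z * z ^ (n div p))" for n
  define j where "j = n mod p"
  have j: "j < p" using p_pos by (simp add: j_def)
  \<comment> \<open>The recurrence is multiplied by \<open>z ^ l\<close> with \<open>l\<close> one
    below \<open>n div p\<close>: the factor \<open>z\<close> restores the exponent belonging to
    \<open>n\<close>, while \<open>l\<close> is already the one belonging to
    \<open>n - p\<close>.\<close>
  obtain l where l: "n div p = Suc l" using n p_pos by (cases "n div p") (auto simp: div_eq_0_iff)
  have n_eq: "n = p * Suc l + j" unfolding l[symmetric] j_def by (simp only: mult_div_mod_eq)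
  have np: "n - p = p * l + j" using n_eq by simp
  have np_mod: "(n - p) mod p = j" "(n - p) div p = l" unfolding np using j by simp_all
  have "multi_orthogonal p \<sigma> (Suc n) (Q (Suc n))"
    using Q[of "Suc n"] by (simp add: multi_orthogonal_poly_def is_arg_min_def)
  then have zero: "nikishin_integral \<sigma> 0 j (\<lambda>z. poly (Q (Suc n)) z * z ^ l) = 0"
    unfolding multi_orthogonal_iff using j n_eq by simp
  have "H n = (\<integral>z. poly (Q (Suc n)) z * z ^ l * f 0 j z +
      of_real (a n) * (poly (Q (n - p)) z * z ^ l * f 0 j z) \<partial>\<sigma> 0)"
    unfolding H_def nikishin_integral_def j_def[symmetric] l
  proof (rule Bochner_Integration.integral_cong)
    fix z
    have "poly (Q n) z * z ^ Suc l * f 0 j z = (z * poly (Q n) z) * z ^ l * f 0 j z" by simp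
    then show "poly (Q n) z * z ^ Suc l * f 0 j z = poly (Q (Suc n)) z * z ^ l * f 0 j z +
        of_real (a n) * (poly (Q (n - p)) z * z ^ l * f 0 j z)"
      unfolding rec[OF n] by (simp add: algebra_simps)
  qed simp
  also have "\<dots> = nikishin_integral \<sigma> 0 j (\<lambda>z. poly (Q (Suc n)) z * z ^ l) + of_real (a n) * H (n - p)"
    unfolding H_def nikishin_integral_def np_mod
    by (subst Bochner_Integration.integral_add)
      (intro integrable_mult_right integrable_poly_f[OF j] refl integral_mult_right_zero arg_cong2[where f = "(+)"])+
  finally have rec_H: "Re (H n) = a n * Re (H (n - p))" unfolding zero by simp
  define s where "s = line.R 0 (n mod (p + 1)) (n div (p + 1))"
  define s' where "s' = line.R 0 ((n - p) mod (p + 1)) ((n - p) div (p + 1))"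
  have pos: "s * Re (H n) > 0" "s' * Re (H (n - p)) > 0" and ss: "s * s' = 1"
    unfolding s_def s'_def H_def by (rule leading_integral_sign[OF Q] leading_sign_ratio[OF n])+
  have "(s * Re (H n)) * (s' * Re (H (n - p))) = (s * s') * (a n * (Re (H (n - p)))\<^sup>2)"
    unfolding rec_H power2_eq_square by (simp only: mult_ac)
  then have "0 < (s * s') * (a n * (Re (H (n - p)))\<^sup>2)" using mult_pos_pos[OF pos] by (simp only:)
  then have "0 < a n * (Re (H (n - p)))\<^sup>2" unfolding ss by simp
  then show ?thesis by (auto simp: zero_less_mult_iff not_less)
qed

end

theorem theorem3p5:
  fixes p :: nat
    and \<alpha> \<beta> :: "nat \<Rightarrow> real"
    and \<sigma> :: "nat \<Rightarrow> complex measure"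
    and Q :: "nat \<Rightarrow> complex poly"
    and a :: "nat \<Rightarrow> real"
  assumes "p \<ge> 1"
    and "\<And>j. j < p \<Longrightarrow> even j \<Longrightarrow> 0 \<le> \<alpha> j \<and> \<alpha> j < \<beta> j"
    and "\<And>j. j < p \<Longrightarrow> odd j \<Longrightarrow> \<alpha> j < \<beta> j \<and> \<beta> j \<le> 0"
    and "\<And>j. Suc j < p \<Longrightarrow>
           star_set p (\<alpha> j) (\<beta> j) \<inter> star_set p (\<alpha> (Suc j)) (\<beta> (Suc j)) = {}"
    and "\<And>j. j < p \<Longrightarrow> star_measure p (star_set p (\<alpha> j) (\<beta> j)) (\<sigma> j)"
    and "\<And>n. multi_orthogonal_poly p \<sigma> n (Q n)"
    and "\<And>n z. n \<ge> p \<Longrightarrow>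
           z * poly (Q n) z = poly (Q (Suc n)) z + of_real (a n) * poly (Q (n - p)) z"
  shows "\<forall>n\<ge>p. a n > 0"
proof -
  interpret star_nikishin p \<alpha> \<beta> \<sigma> by unfold_locales (fact assms)+
  show ?thesis using recurrence_coefficient_pos[OF assms(6,7)] by blast
qed

end
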